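(* Let $G$ be a finite graph and $k\ge 2$ an integer. Maker has a winning strategy in the arboricity-$k$ game on $G$ if and only if $k\le \lceil \mathrm{ar}(G)/2\rceil$. Moreover, whether Maker wins can be decided in polynomial time.
   Context: The arboricity $\mathrm{ar}(G)$ of a graph $G$ is the minimum number of forests into which its edge set can be partitioned. In the arboricity-$k$ game on $G$ ($k\ge 2$), Maker and Breaker alternately claim previously unclaimed edges of $G$, Maker first, until all edges are claimed; Maker wins if the graph formed by her claimed edges has arboricity at least $k$, and Breaker wins otherwise. *)

theory Defs
  imports
    Complex_Main
    "HOL-Library.Disjoint_Sets"
    "HOL-Computational_Algebra.Polynomial"
begin

section \<open>Graphs and arboricity\<close>

definition finite_graph :: "'a set \<Rightarrow> 'a set set \<Rightarrow> bool" where
  "finite_graph V E \<longleftrightarrow> finite V \<and> (\<forall>e\<in>E. e \<subseteq> V \<and> card e = 2)"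

definition is_cycle :: "'a set set \<Rightarrow> 'a list \<Rightarrow> bool" where
  "is_cycle F vs \<longleftrightarrow> 3 \<le> length vs \<and> distinct vs \<and>
     (\<forall>i<length vs. {vs ! i, vs ! (Suc i mod length vs)} \<in> F)"

text \<open>Isolated vertices are irrelevant to being a forest, so forests and arboricity are
  functions of the edge set alone.\<close>

definition forest :: "'a set set \<Rightarrow> bool" where
  "forest F \<longleftrightarrow> (\<nexists>vs. is_cycle F vs)"

definition arboricity :: "'a set set \<Rightarrow> nat" where
  "arboricity E = (LEAST n. \<exists>P. partition_on E P \<and> finite P \<and> card P = n \<and> (\<forall>F\<in>P. forest F))"

section \<open>Maker-Breaker games, Maker moving first\<close>

text \<open>A history is the list of the elements of the board \<open>X\<close> claimed so far, in order; the
  elements at even positions are Maker's. A complete play enumerates the whole board.\<close>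

definition maker_part :: "'b list \<Rightarrow> 'b set" where
  "maker_part p = {p ! i | i. i < length p \<and> even i}"

definition maker_strategy :: "'b set \<Rightarrow> ('b list \<Rightarrow> 'b) \<Rightarrow> bool" where
  "maker_strategy X \<sigma> \<longleftrightarrow>
     (\<forall>h. distinct h \<and> set h \<subset> X \<and> even (length h) \<longrightarrow> \<sigma> h \<in> X - set h)"

definition complete_play :: "'b set \<Rightarrow> 'b list \<Rightarrow> bool" where
  "complete_play X p \<longleftrightarrow> distinct p \<and> set p = X"

definition follows_strategy :: "('b list \<Rightarrow> 'b) \<Rightarrow> 'b list \<Rightarrow> bool" where
  "follows_strategy \<sigma> p \<longleftrightarrow> (\<forall>i<length p. even i \<longrightarrow> p ! i = \<sigma> (take i p))"

definition maker_has_winning_strategy :: "'b set \<Rightarrow> ('b set \<Rightarrow> bool) \<Rightarrow> bool" where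
  "maker_has_winning_strategy X Win \<longleftrightarrow>
     (\<exists>\<sigma>. maker_strategy X \<sigma> \<and>
          (\<forall>p. complete_play X p \<and> follows_strategy \<sigma> p \<longrightarrow> Win (maker_part p)))"

definition maker_wins_arboricity :: "nat \<Rightarrow> 'a set set \<Rightarrow> bool" where
  "maker_wins_arboricity k E \<longleftrightarrow> maker_has_winning_strategy E (\<lambda>M. k \<le> arboricity M)"

section \<open>Polynomial-time decidability\<close>

text \<open>The machine model is a random access machine, presented with structured control flow. Its
  state consists of registers, of which a program names only finitely many, and an indirectly
  addressed memory. Each instruction and each test costs one step. As the only arithmetic is
  addition and truncated subtraction, a step lengthens the largest number stored by at most one
  bit (up to the constants of the program), so that polynomial time on this machine coincides
  with polynomial time on Turing machines.\<close>

datatype com =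
    Const nat nat    \<comment> \<open>\<open>R\<^sub>i := n\<close>\<close>
  | Add nat nat nat  \<comment> \<open>\<open>R\<^sub>i := R\<^sub>j + R\<^sub>l\<close>\<close>
  | Sub nat nat nat  \<comment> \<open>\<open>R\<^sub>i := R\<^sub>j - R\<^sub>l\<close>, truncated at 0\<close>
  | Load nat nat     \<comment> \<open>\<open>R\<^sub>i := M[R\<^sub>j]\<close>\<close>
  | Store nat nat    \<comment> \<open>\<open>M[R\<^sub>i] := R\<^sub>j\<close>\<close>
  | Seq com com
  | If nat com com   \<comment> \<open>first branch if \<open>R\<^sub>i \<noteq> 0\<close>\<close>
  | While nat com    \<comment> \<open>loop as long as \<open>R\<^sub>i \<noteq> 0\<close>\<close>

type_synonym state = "(nat \<Rightarrow> nat) \<times> (nat \<Rightarrow> nat)"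

text \<open>\<open>exec c s t s'\<close>: started in state \<open>s\<close>, the program \<open>c\<close> halts in state \<open>s'\<close> after exactly
  \<open>t\<close> steps.\<close>

inductive exec :: "com \<Rightarrow> state \<Rightarrow> nat \<Rightarrow> state \<Rightarrow> bool" where
  Const: "exec (Const i n) (R, M) 1 (R(i := n), M)"
| Add: "exec (Add i j l) (R, M) 1 (R(i := R j + R l), M)"
| Sub: "exec (Sub i j l) (R, M) 1 (R(i := R j - R l), M)"
| Load: "exec (Load i j) (R, M) 1 (R(i := M (R j)), M)"
| Store: "exec (Store i j) (R, M) 1 (R, M(R i := R j))"
| Seq: "exec c s t s' \<Longrightarrow> exec d s' u s'' \<Longrightarrow> exec (Seq c d) s (t + u) s''"
| If_True: "R i \<noteq> 0 \<Longrightarrow> exec c (R, M) t s' \<Longrightarrow> exec (If i c d) (R, M) (Suc t) s'"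
| If_False: "R i = 0 \<Longrightarrow> exec d (R, M) t s' \<Longrightarrow> exec (If i c d) (R, M) (Suc t) s'"
| While_True: "R i \<noteq> 0 \<Longrightarrow> exec c (R, M) t s' \<Longrightarrow> exec (While i c) s' u s'' \<Longrightarrow>
    exec (While i c) (R, M) (Suc (t + u)) s''"
| While_False: "R i = 0 \<Longrightarrow> exec (While i c) (R, M) 1 (R, M)"

lemma exec_deterministic:
  "exec c s t s' \<Longrightarrow> exec c s t' s'' \<Longrightarrow> t = t' \<and> s' = s''"
proof (induction arbitrary: t' s'' rule: exec.induct)
  case (Seq c s t s1 d u s2)
  from Seq.prems Seq.IH show ?case by (cases rule: exec.cases) blast+
next
  case (While_True R i c M t s1 u s2)
  from While_True.prems While_True.hyps While_True.IH show ?case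
    by (cases rule: exec.cases) blast+
qed (erule exec.cases; auto)+

definition initial_state :: "bool list \<Rightarrow> state" where
  "initial_state w = ((\<lambda>_. 0)(0 := length w), \<lambda>a. if a < length w then of_bool (w ! a) else 0)"

definition accepting :: "state \<Rightarrow> bool" where
  "accepting s \<longleftrightarrow> fst s 0 \<noteq> 0"

definition polynomial_time_decidable :: "bool list set \<Rightarrow> bool" where
  "polynomial_time_decidable L \<longleftrightarrow>
     (\<exists>c (p :: nat poly). \<forall>w. \<exists>t s. exec c (initial_state w) t s \<and>
        t \<le> poly p (length w) \<and> (accepting s \<longleftrightarrow> w \<in> L))"

section \<open>The decision problem\<close>

text \<open>Binary representation, most significant bit first.\<close>

fun binary :: "nat \<Rightarrow> bool list" where
  "binary n = (if n = 0 then [] else binary (n div 2) @ [odd n])"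

declare binary.simps [simp del]

text \<open>An instance is a graph on the vertices \<open>0, \<dots>, n - 1\<close> together with a number \<open>k\<close>: \<open>n\<close> in
  unary with an end marker, the adjacency matrix row by row, and \<open>k\<close> in binary.\<close>

definition encode :: "nat \<Rightarrow> nat set set \<Rightarrow> nat \<Rightarrow> bool list" where
  "encode n E k = replicate n True @ [False] @
     concat (map (\<lambda>i. map (\<lambda>j. {i, j} \<in> E) [0..<n]) [0..<n]) @ binary k"

definition arboricity_game_language :: "bool list set" where
  "arboricity_game_language =
     {encode n E k | n E k. finite_graph {..<n} E \<and> 2 \<le> k \<and> maker_wins_arboricity k E}"

end

theory Submission
  imports Defs
begin

text \<open>Call a nonempty vertex set \<open>S\<close> dense for \<open>t\<close> if it spans more than \<open>t * (|S| - 1)\<close> edges. By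
  Nash-Williams, \<open>ar(G) > t\<close> iff there is a dense set for \<open>t\<close>. If \<open>ar(G) > 2k - 2\<close>, Maker claims edges
  inside a dense set for \<open>2k - 2\<close> as long as possible; she gets at least half of them, which is too many
  for \<open>k - 1\<close> forests. Otherwise Breaker pairs up \<open>2k - 2\<close> forests covering \<open>G\<close> and answers within the
  pair in which Maker has just played: a forest exchange, as in Lehman's switching game, keeps both
  forests of the pair containing all of Maker's edges in their union.

  A set is dense iff it violates, for one of its vertices \<open>r\<close>, Hakimi's condition for an orientation
  with out-degree 0 at \<open>r\<close> and at most \<open>t\<close> elsewhere. Push-relabel decides the existence of such an
  orientation with purely local steps, so that the program needs no path search.\<close>

section \<open>Connectivity and rank\<close>

text \<open>The subtracted 1 in \<open>t * (card S - 1)\<close> is what the root is for: with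
  capacity 0 at \<open>r\<close> and \<open>c\<close> elsewhere, a set containing \<open>r\<close>
  has capacity \<open>c * (card S - 1)\<close> and a set avoiding \<open>r\<close> has at least as
  much, so some root has an overfull set iff some set is dense. Edges are doubled, so
  \<open>c = 2 * t\<close>, and the game has \<open>t = 2 * (k - 1)\<close>; this gives the constant
  \<open>4 * (k - 1)\<close> of the program. Breaker treats Maker's edges as contracted and his own
  as deleted. When all edges are claimed, each of the \<open>k - 1\<close> pairs has collapsed to a
  single forest of Maker's edges. The hard half of Nash-Williams is a case of matroid union, for
  which only the rank axioms of the graphic matroid are used. As \<open>k\<close> is given in
  binary, it may be exponential in the length of the input. The program only adds, subtracts and
  compares numbers of that size, and no loop bound depends on them: the potential that bounds the
  pushes and relabels does not mention the capacities.\<close>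

definition conn :: "'a set set \<Rightarrow> ('a \<times> 'a) set" where
  "conn F = {(u, v). {u, v} \<in> F}\<^sup>*"

definition comps :: "'a set \<Rightarrow> 'a set set \<Rightarrow> nat" where
  "comps V F = card (V // conn F)"

text \<open>The rank function of the graphic matroid: the size of a spanning forest of
  \<open>F\<close>.\<close>

definition rk :: "'a set \<Rightarrow> 'a set set \<Rightarrow> nat" where
  "rk V F = card V - comps V F"

lemma conn_refl [simp]: "(u, u) \<in> conn F"
  by (simp add: conn_def)

lemma sym_conn: "sym (conn F)"
  unfolding conn_def by (intro sym_rtrancl symI) (auto simp: insert_commute)

lemma conn_sym: "(u, v) \<in> conn F \<Longrightarrow> (v, u) \<in> conn F"
  using sym_conn by (rule symD)

lemma conn_trans: "(u, v) \<in> conn F \<Longrightarrow> (v, w) \<in> conn F \<Longrightarrow> (u, w) \<in> conn F"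
  unfolding conn_def by (rule rtrancl_trans)

lemma equiv_conn: "equiv UNIV (conn F)"
  by (intro equivI refl_onI sym_conn transI) (auto intro: conn_trans)

lemma conn_edge: "{u, v} \<in> F \<Longrightarrow> (u, v) \<in> conn F"
  by (auto simp: conn_def)

lemma conn_mono: "F \<subseteq> F' \<Longrightarrow> conn F \<subseteq> conn F'"
  unfolding conn_def by (intro rtrancl_mono) auto

lemma conn_empty [simp]: "conn {} = Id"
  by (simp add: conn_def)

lemma conn_insert_iff:
  "(x, y) \<in> conn (insert {u, v} F) \<longleftrightarrow> (x, y) \<in> conn F \<or>
     ((x, u) \<in> conn F \<or> (x, v) \<in> conn F) \<and> ((u, y) \<in> conn F \<or> (v, y) \<in> conn F)"
proof -
  have "{(a, b). {a, b} \<in> insert {u, v} F} = insert (u, v) (insert (v, u) {(a, b). {a, b} \<in> F})"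
    by (auto simp: doubleton_eq_iff)
  then have "conn (insert {u, v} F) = (insert (u, v) (insert (v, u) {(a, b). {a, b} \<in> F}))\<^sup>*"
    by (simp add: conn_def)
  then have "(x, y) \<in> conn (insert {u, v} F) \<longleftrightarrow> (x, y) \<in> conn F \<or>
     (x, v) \<in> conn F \<and> (u, y) \<in> conn F \<or>
     ((x, u) \<in> conn F \<or> (x, v) \<in> conn F \<and> (u, u) \<in> conn F) \<and>
     ((v, y) \<in> conn F \<or> (v, v) \<in> conn F \<and> (u, y) \<in> conn F)"
    by (simp add: rtrancl_insert flip: conn_def)
  then show ?thesis
    using conn_trans[of x u F y] conn_trans[of x v F y] by auto
qed

lemma conn_insert_same: "(u, v) \<in> conn F \<Longrightarrow> conn (insert {u, v} F) = conn F"
  by (auto simp: conn_insert_iff) (blast intro: conn_sym conn_trans)+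

lemma conn_class_eq_iff: "conn F `` {x} = conn F `` {y} \<longleftrightarrow> (x, y) \<in> conn F"
  using eq_equiv_class_iff[OF equiv_conn, of x y F] by simp

text \<open>Only the classes of \<open>u\<close> and \<open>v\<close> change: if they differ, their
  union replaces both, so the number of classes drops by one.\<close>

lemma comps_insert:
  assumes "finite V" "u \<in> V" "v \<in> V"
  shows "comps V F = comps V (insert {u, v} F) + (if (u, v) \<in> conn F then 0 else 1)"
proof (cases "(u, v) \<in> conn F")
  case True
  then show ?thesis by (simp add: comps_def conn_insert_same)
next
  case False
  let ?C = "conn F" and ?C' = "conn (insert {u, v} F)"
  let ?U = "?C `` {u}" and ?W = "?C `` {v}"
  have cls: "?C' `` {x} = (if x \<in> ?U \<union> ?W then ?U \<union> ?W else ?C `` {x})" for x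
    by (auto simp: conn_insert_iff intro: conn_sym conn_trans)
  have "V // ?C' = insert (?U \<union> ?W) (V // ?C - {?U, ?W})"
  proof
    show "V // ?C' \<subseteq> insert (?U \<union> ?W) (V // ?C - {?U, ?W})"
    proof
      fix X assume "X \<in> V // ?C'"
      then obtain x where x: "x \<in> V" "X = ?C' `` {x}" by (auto elim: quotientE)
      show "X \<in> insert (?U \<union> ?W) (V // ?C - {?U, ?W})"
      proof (cases "x \<in> ?U \<union> ?W")
        case True
        then show ?thesis using x cls by simp
      next
        case False
        then have "X = ?C `` {x}" using x cls by simp
        moreover have "?C `` {x} \<noteq> ?U" "?C `` {x} \<noteq> ?W"
          using False by (auto simp: conn_class_eq_iff intro: conn_sym)
        ultimately show ?thesis using x by (auto intro: quotientI)
      qed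
    qed
  next
    show "insert (?U \<union> ?W) (V // ?C - {?U, ?W}) \<subseteq> V // ?C'"
    proof
      fix X assume "X \<in> insert (?U \<union> ?W) (V // ?C - {?U, ?W})"
      then consider "X = ?U \<union> ?W" | "X \<in> V // ?C" "X \<noteq> ?U" "X \<noteq> ?W" by auto
      then show "X \<in> V // ?C'"
      proof cases
        case 1
        then have "X = ?C' `` {u}" using cls by auto
        then show ?thesis using assms by (auto intro: quotientI)
      next
        case 2
        then obtain x where x: "x \<in> V" "X = ?C `` {x}" by (auto elim: quotientE)
        have "x \<notin> ?U \<union> ?W"
          using 2 unfolding x(2) conn_class_eq_iff by (auto intro: conn_sym)
        then have "X = ?C' `` {x}" using x cls by simp
        then show ?thesis using x by (auto intro: quotientI)
      qed
    qed
  qed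
  moreover have fin: "finite (V // ?C)"
    unfolding quotient_def using \<open>finite V\<close> by simp
  moreover have UW: "?U \<in> V // ?C" "?W \<in> V // ?C" "?U \<noteq> ?W"
    using assms False by (auto intro: quotientI simp: conn_class_eq_iff)
  \<comment> \<open>The union is not an old class, since an old class containing \<open>u\<close> is
    \<open>?U\<close>; hence \<open>insert\<close> really adds a class.\<close>
  moreover have "?U \<union> ?W \<notin> V // ?C - {?U, ?W}"
  proof
    assume "?U \<union> ?W \<in> V // ?C - {?U, ?W}"
    then have "?U \<union> ?W \<in> V // ?C" and ne: "?U \<union> ?W \<noteq> ?U" by simp_all
    then obtain x where x: "?U \<union> ?W = ?C `` {x}" by (elim quotientE)
    moreover have "u \<in> ?U \<union> ?W" by simp
    ultimately have "(x, u) \<in> ?C" by simp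
    then show False using x ne conn_class_eq_iff[of F x u] by metis
  qed
  moreover have "card {?U, ?W} \<le> card (V // ?C)"
    using fin UW by (intro card_mono) simp_all
  then have "2 \<le> card (V // ?C)" using UW by simp
  moreover have "card (V // ?C - {?U, ?W}) = card (V // ?C) - 2"
    using UW by (subst card_Diff_subset) simp_all
  ultimately show ?thesis
    using False by (simp add: comps_def)
qed

lemma comps_empty [simp]: "comps V {} = card V"
proof -
  have "V // Id = (\<lambda>x. {x}) ` V" by (auto simp: quotient_def)
  then show ?thesis by (simp add: comps_def card_image)
qed

lemma comps_le: "finite V \<Longrightarrow> comps V F \<le> card V"
proof -
  have "V // conn F = (\<lambda>x. conn F `` {x}) ` V" by (auto simp: quotient_def)
  then show "finite V \<Longrightarrow> comps V F \<le> card V" by (simp add: comps_def card_image_le)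
qed

lemma comps_pos: "finite V \<Longrightarrow> V \<noteq> {} \<Longrightarrow> 0 < comps V F"
  unfolding comps_def quotient_def by (auto simp: card_gt_0_iff)

lemma finite_graphD: "finite_graph V E \<Longrightarrow> finite V \<and> finite E"
  unfolding finite_graph_def
  by (meson finite_Pow_iff finite_subset PowI subsetI)

lemma finite_graph_subset: "finite_graph V E \<Longrightarrow> F \<subseteq> E \<Longrightarrow> finite_graph V F"
  by (auto simp: finite_graph_def)

lemma finite_graph_edgeE:
  assumes "finite_graph V E" "e \<in> E"
  obtains u v where "e = {u, v}" "u \<noteq> v" "u \<in> V" "v \<in> V"
  using assms unfolding finite_graph_def by (metis card_2_iff insert_subset)

lemma rk_empty [simp]: "rk V {} = 0"
  by (simp add: rk_def)

lemma rk_insert: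
  assumes "finite V" "u \<in> V" "v \<in> V"
  shows "rk V (insert {u, v} F) = rk V F + (if (u, v) \<in> conn F then 0 else 1)"
  using comps_insert[OF assms, of F] comps_le[OF assms(1), of F] by (auto simp: rk_def)

lemma rk_le_card:
  assumes "finite_graph V F" shows "rk V F \<le> card F"
proof -
  have "finite F" using finite_graphD[OF assms] by simp
  then show ?thesis using assms
  proof (induction F)
    case (insert e F)
    obtain u v where "e = {u, v}" "u \<in> V" "v \<in> V"
      using insert.prems by (rule finite_graph_edgeE) auto
    then show ?case
      using insert rk_insert[of V u v F] finite_graph_subset[OF insert.prems, of F] finite_graphD[OF insert.prems]
      by (auto simp: subset_insertI le_Suc_eq)
  qed simp
qed

text \<open>The marginal gain of an edge is the indicator of its ends being disconnected, which
  decreases as the set grows; this is submodularity.\<close>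

lemma rk_marginal:
  assumes "finite V" "u \<in> V" "v \<in> V" "Y \<subseteq> X"
  shows "rk V (insert {u, v} X) + rk V Y \<le> rk V X + rk V (insert {u, v} Y)"
  using conn_mono[OF assms(4)] by (auto simp: rk_insert[OF assms(1-3)])

lemma rk_union:
  assumes "finite Z" "finite_graph V Z" "Y \<subseteq> X"
  shows "rk V (X \<union> Z) + rk V Y \<le> rk V X + rk V (Y \<union> Z)"
  using assms
proof (induction Z)
  case (insert e Z)
  obtain u v where e: "e = {u, v}" "u \<in> V" "v \<in> V"
    using insert.prems(1) by (rule finite_graph_edgeE) auto
  have "rk V (insert {u, v} (X \<union> Z)) + rk V (Y \<union> Z)
      \<le> rk V (X \<union> Z) + rk V (insert {u, v} (Y \<union> Z))"
    using insert.prems finite_graphD[OF insert.prems(1)] by (intro rk_marginal e) auto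
  moreover have "rk V (X \<union> Z) + rk V Y \<le> rk V X + rk V (Y \<union> Z)"
    using insert.prems by (intro insert.IH finite_graph_subset[OF insert.prems(1)]) auto
  ultimately show ?case by (simp add: e)
qed simp

text \<open>Adding \<open>B - A\<close> gains over \<open>A\<close> at most what it gains over the
  smaller set \<open>A \<inter> B\<close>.\<close>

lemma rk_submodular:
  assumes "finite_graph V B"
  shows "rk V (A \<union> B) + rk V (A \<inter> B) \<le> rk V A + rk V B"
proof -
  have "rk V (A \<union> (B - A)) + rk V (A \<inter> B) \<le> rk V A + rk V ((A \<inter> B) \<union> (B - A))"
    using finite_graphD[OF assms] by (intro rk_union finite_graph_subset[OF assms]) auto
  then show ?thesis by (simp add: Int_Diff_Un Un_Diff_cancel)
      (metis Int_Diff_Un Int_commute)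
qed

lemma rk_mono:
  assumes "finite_graph V B" "A \<subseteq> B"
  shows "rk V A \<le> rk V B"
proof -
  have "rk V A \<le> rk V (A \<union> Z)" if "finite Z" "finite_graph V Z" for Z
    using that
  proof (induction Z)
    case (insert e Z)
    obtain u v where e: "e = {u, v}" "u \<in> V" "v \<in> V"
      using insert.prems by (rule finite_graph_edgeE) auto
    have "finite_graph V Z" by (rule finite_graph_subset[OF insert.prems]) blast
    then have "rk V A \<le> rk V (A \<union> Z)" by (rule insert.IH)
    then show ?case
      using e rk_insert[of V u v "A \<union> Z"] finite_graphD[OF insert.prems] by simp
  qed simp
  then have "rk V A \<le> rk V (A \<union> B)" using finite_graphD[OF assms(1)] assms(1) by simp
  then show ?thesis using assms(2) by (simp add: Un_absorb1)
qed

section \<open>Forests\<close>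

text \<open>A walk is kept simple as it grows: when it returns to a visited vertex, it is cut back
  to that vertex. Cycles are lists of distinct vertices, so a mere walk would not do.\<close>

lemma conn_path:
  assumes "(u, v) \<in> conn F"
  shows "\<exists>xs. xs \<noteq> [] \<and> hd xs = u \<and> last xs = v \<and> distinct xs \<and>
    (\<forall>i. Suc i < length xs \<longrightarrow> {xs ! i, xs ! Suc i} \<in> F)"
  using assms unfolding conn_def
proof (induction rule: rtrancl_induct)
  case base
  show ?case by (rule exI[of _ "[u]"]) simp
next
  case (step v w)
  then obtain xs where xs: "xs \<noteq> []" "hd xs = u" "last xs = v" "distinct xs"
    "\<And>i. Suc i < length xs \<Longrightarrow> {xs ! i, xs ! Suc i} \<in> F" by auto
  show ?case
  proof (cases "w \<in> set xs")
    case True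
    then obtain i where i: "i < length xs" "xs ! i = w" by (auto simp: in_set_conv_nth)
    then have "last (take (Suc i) xs) = w" by (simp add: take_Suc_conv_app_nth)
    moreover have "hd (take (Suc i) xs) = u" using xs by (simp add: hd_take)
    ultimately show ?thesis
      using i xs by (intro exI[of _ "take (Suc i) xs"]) auto
  next
    case False
    have "{(xs @ [w]) ! i, (xs @ [w]) ! Suc i} \<in> F" if "Suc i < length (xs @ [w])" for i
    proof (cases "Suc i < length xs")
      case True
      then show ?thesis using xs(5)[of i] by (simp add: nth_append)
    next
      case False
      then have "i = length xs - 1" "Suc i = length xs" using that by auto
      then show ?thesis using step(2) xs(1,3) by (simp add: nth_append last_conv_nth)
    qed
    then show ?thesis
      using xs False by (intro exI[of _ "xs @ [w]"]) auto
  qed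
qed

lemma forest_subset: "forest F \<Longrightarrow> F' \<subseteq> F \<Longrightarrow> forest F'"
  unfolding forest_def is_cycle_def by blast

lemma forest_empty [simp]: "forest {}"
  by (auto simp: forest_def is_cycle_def intro!: exI[of _ 0])

text \<open>The new edge closes a simple path into a cycle. The path has at least three vertices:
  one would mean \<open>u = v\<close>, two would mean that the path is the edge itself, which is not
  in \<open>F\<close>.\<close>

lemma conn_not_forest:
  assumes "(u, v) \<in> conn F" "u \<noteq> v" "{u, v} \<notin> F"
  shows "\<not> forest (insert {u, v} F)"
proof -
  obtain xs where xs: "xs \<noteq> []" "hd xs = u" "last xs = v" "distinct xs"
    "\<And>i. Suc i < length xs \<Longrightarrow> {xs ! i, xs ! Suc i} \<in> F"
    using conn_path[OF assms(1)] by auto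
  have n1: "length xs \<noteq> 1" using xs assms(2) by (auto simp: length_Suc_conv)
  have n2: "length xs \<noteq> 2"
  proof
    assume "length xs = 2"
    then have "xs = [u, v]" using xs by (auto simp: length_Suc_conv numeral_2_eq_2)
    then show False using xs(5)[of 0] assms(3) by simp
  qed
  have "{xs ! i, xs ! (Suc i mod length xs)} \<in> insert {u, v} F" if "i < length xs" for i
  proof (cases "Suc i < length xs")
    case True
    then show ?thesis using xs(5) by simp
  next
    case False
    then have "Suc i = length xs" using that by simp
    then have "{xs ! i, xs ! (Suc i mod length xs)} = {v, u}"
      using xs by (metis diff_Suc_1 hd_conv_nth last_conv_nth mod_self)
    then show ?thesis by (auto simp: insert_commute)
  qed
  moreover have "length xs \<noteq> 0" using xs by simp
  with n1 n2 have "3 \<le> length xs" by linarith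
  ultimately have "is_cycle (insert {u, v} F) xs"
    using xs by (simp add: is_cycle_def)
  then show ?thesis by (auto simp: forest_def)
qed

lemma Suc_mod_less: "i < n \<Longrightarrow> Suc i mod n = (if Suc i = n then 0 else Suc i)"
  by (cases "Suc i = n") simp_all

lemma cyclic_Suc_absurd:
  fixes i j n :: nat
  assumes "i = (if Suc j = n then 0 else Suc j)" "j = (if Suc i = n then 0 else Suc i)" "3 \<le> n"
  shows False
proof -
  have "Suc j = n \<and> i = 0 \<or> i = Suc j" using assms(1) by metis
  moreover have "Suc i = n \<and> j = 0 \<or> j = Suc i" using assms(2) by metis
  ultimately show False using assms(3) by linarith
qed

text \<open>Two positions with the same edge would each be the cyclic successor of the other, which
  needs a cycle of length at most two.\<close>

lemma cycle_edges_distinct: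
  assumes "is_cycle F vs" "i < length vs" "j < length vs"
    "{vs ! i, vs ! (Suc i mod length vs)} = {vs ! j, vs ! (Suc j mod length vs)}"
  shows "i = j"
proof (rule ccontr)
  assume "i \<noteq> j"
  have vs: "3 \<le> length vs" "distinct vs" using assms(1) by (auto simp: is_cycle_def)
  have lt: "Suc i mod length vs < length vs" "Suc j mod length vs < length vs"
    using vs(1) by (auto intro!: mod_less_divisor)
  have "vs ! i \<noteq> vs ! j" using vs(2) assms(2,3) \<open>i \<noteq> j\<close> by (simp add: nth_eq_iff_index_eq)
  then have "vs ! i = vs ! (Suc j mod length vs)" "vs ! j = vs ! (Suc i mod length vs)"
    using assms(4) by (auto simp: doubleton_eq_iff)
  then have "i = Suc j mod length vs" "j = Suc i mod length vs"
    using nth_eq_iff_index_eq[OF vs(2) assms(2), of "Suc j mod length vs"]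
      nth_eq_iff_index_eq[OF vs(2) assms(3), of "Suc i mod length vs"] lt by blast+
  then have "i = (if Suc j = length vs then 0 else Suc j)" "j = (if Suc i = length vs then 0 else Suc i)"
    unfolding Suc_mod_less[OF assms(2)] Suc_mod_less[OF assms(3)] .
  from cyclic_Suc_absurd[OF this vs(1)] show False .
qed

text \<open>A cycle must pass through the new edge; the rest of the cycle then joins
  \<open>u\<close> and \<open>v\<close> within \<open>F\<close>.\<close>

lemma forest_insert:
  assumes "forest F" "(u, v) \<notin> conn F"
  shows "forest (insert {u, v} F)"
  unfolding forest_def
proof
  assume "\<exists>vs. is_cycle (insert {u, v} F) vs"
  then obtain vs where cyc: "is_cycle (insert {u, v} F) vs" ..
  let ?n = "length vs"
  have vs: "3 \<le> ?n" "distinct vs"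
    and ed: "\<And>i. i < ?n \<Longrightarrow> {vs ! i, vs ! (Suc i mod ?n)} \<in> insert {u, v} F"
    using cyc by (auto simp: is_cycle_def)
  have "\<not> is_cycle F vs" using assms(1) by (auto simp: forest_def)
  then obtain i where i: "i < ?n" "{vs ! i, vs ! (Suc i mod ?n)} \<notin> F"
    using vs by (auto simp: is_cycle_def)
  then have iuv: "{vs ! i, vs ! (Suc i mod ?n)} = {u, v}" using ed by auto
  \<comment> \<open>Walking on from position \<open>i\<close>, the new edge is not met again, as the
    edges of a cycle are distinct; after \<open>?n - 1\<close> steps the walk is back at
    \<open>i\<close>.\<close>
  have path: "(vs ! (Suc i mod ?n), vs ! ((Suc i + k) mod ?n)) \<in> conn F" if "k < ?n" for k
    using that
  proof (induction k)
    case (Suc k)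
    let ?j = "(Suc i + k) mod ?n"
    have j: "?j < ?n" using i(1) by (intro mod_less_divisor) linarith
    have "?j \<noteq> i" using i(1) Suc.prems
      by (cases "Suc i + k < ?n") (auto simp: mod_if)
    then have "{vs ! ?j, vs ! (Suc ?j mod ?n)} \<in> F"
      using cycle_edges_distinct[OF cyc j i(1)] ed[OF j] iuv by auto
    then have "(vs ! ?j, vs ! ((Suc i + Suc k) mod ?n)) \<in> conn F"
      by (intro conn_edge) (simp add: mod_Suc_eq)
    then show ?case using Suc by (auto intro: conn_trans)
  qed simp
  have "Suc i + (?n - 1) = i + ?n" using i(1) by simp
  then have "(Suc i + (?n - 1)) mod ?n = i" using i(1) by simp
  then have "(vs ! (Suc i mod ?n), vs ! i) \<in> conn F" using path[of "?n - 1"] i(1) by simp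
  then show False using iuv assms(2) by (auto simp: doubleton_eq_iff intro: conn_sym)
qed

text \<open>Each edge adds one to the size, and one to the rank unless it closes a cycle. Since the
  rank never exceeds the size, a rank that has once fallen behind cannot catch up.\<close>

lemma forest_iff_rk:
  assumes "finite_graph V F"
  shows "forest F \<longleftrightarrow> rk V F = card F"
proof -
  have "finite F" using finite_graphD[OF assms] by simp
  then show ?thesis using assms
  proof (induction F)
    case (insert e F)
    obtain u v where e: "e = {u, v}" "u \<noteq> v" "u \<in> V" "v \<in> V"
      using insert.prems by (rule finite_graph_edgeE) auto
    have g: "finite_graph V F" using finite_graph_subset[OF insert.prems] by auto
    have r: "rk V (insert e F) = rk V F + (if (u, v) \<in> conn F then 0 else 1)"
      using e finite_graphD[OF g] by (simp add: rk_insert)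
    have le: "rk V F \<le> card F" using rk_le_card[OF g] .
    show ?case
    proof (cases "(u, v) \<in> conn F")
      case True
      then show ?thesis using conn_not_forest[of u v F] e insert r le by simp
    next
      case False
      then show ?thesis
        using forest_insert[of F u v] e insert r g forest_subset[of "insert e F" F] by auto
    qed
  qed simp
qed

text \<open>If every edge of \<open>J\<close> closed a cycle with \<open>I\<close>, then
  \<open>J\<close> would add no connection to \<open>I\<close>, so its rank, which is its size,
  could not exceed that of \<open>I\<close>.\<close>

lemma forest_augment:
  assumes "finite_graph V I" "finite_graph V J" "forest I" "forest J" "card I < card J"
  shows "\<exists>e\<in>J - I. forest (insert e I)"
proof (rule ccontr)
  assume neg: "\<not> ?thesis"
  have "finite J" using finite_graphD assms by blast
  moreover have "conn (I \<union> K) = conn I" if "finite K" "K \<subseteq> J" for K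
    using that
  proof (induction K)
    case (insert e K)
    obtain u v where e: "e = {u, v}"
      using assms(2) insert.prems by (metis finite_graph_edgeE insert_subset)
    have "(u, v) \<in> conn I"
      using neg insert.prems forest_insert[OF assms(3)] e conn_edge[of u v I] by auto
    then show ?case
      using insert e conn_insert_same[of u v "I \<union> K"] by auto
  qed simp
  ultimately have "conn (I \<union> J) = conn I" by simp
  then have "rk V (I \<union> J) = rk V I" by (simp add: rk_def comps_def)
  moreover have "rk V J \<le> rk V (I \<union> J)"
    using assms(1,2) by (intro rk_mono) (auto simp: finite_graph_def)
  ultimately show False using assms by (simp add: forest_iff_rk)
qed

text \<open>A largest forest between \<open>insert e (A \<inter> B)\<close> and
  \<open>insert e B\<close> has at least \<open>card B\<close> edges by augmentation, so it misses a
  single edge \<open>f\<close>. Starting from \<open>A \<inter> B\<close> forces \<open>f\<close>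
  outside \<open>A\<close>: deleting \<open>f\<close> from the pair then leaves \<open>A\<close>
  untouched.\<close>

lemma forest_exchange:
  assumes "finite_graph V A" "finite_graph V B" "forest A" "forest B" "e \<in> A" "\<not> forest (insert e B)"
  shows "\<exists>f\<in>B - A. forest (insert e (B - {f}))"
proof -
  have fin: "finite A" "finite B" using assms finite_graphD by auto
  have "e \<notin> B" using assms by (auto simp: insert_absorb)
  let ?P = "\<lambda>I. insert e (A \<inter> B) \<subseteq> I \<and> I \<subseteq> insert e B \<and> forest I"
  have P0: "?P (insert e (A \<inter> B))"
    using assms forest_subset[of A "insert e (A \<inter> B)"] by auto
  have bd: "\<forall>I. ?P I \<longrightarrow> card I < Suc (card (insert e B))"
    using fin by (auto intro!: card_mono simp: less_Suc_eq_le simp del: card_insert_disjoint)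
  obtain I where I: "?P I" and mx: "\<And>I'. ?P I' \<Longrightarrow> card I' \<le> card I"
    using ex_has_greatest_nat[of ?P _ card, OF P0 bd] by auto
  have gI: "finite_graph V I" using I assms by (auto simp: finite_graph_def)
  have "\<not> card I < card B"
  proof
    assume "card I < card B"
    then obtain f where f: "f \<in> B - I" "forest (insert f I)"
      using forest_augment[OF gI assms(2)] I assms by auto
    then have "card (insert f I) \<le> card I" using I by (intro mx) auto
    then show False using f finite_graphD[OF gI] by auto
  qed
  moreover have "I \<noteq> insert e B" using I assms by auto
  then obtain f where f: "f \<in> insert e B" "f \<notin> I" using I by auto
  then have f': "f \<in> B" "f \<notin> A" "f \<noteq> e" using I by auto
  have "I \<subseteq> insert e (B - {f})" using I f by auto
  moreover have "card (insert e (B - {f})) = card B"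
    using f' fin \<open>e \<notin> B\<close> by (simp add: card_insert_if card_Suc_Diff1 del: card_Diff_insert)
  ultimately have "I = insert e (B - {f})"
    using fin by (intro card_seteq) auto
  then show ?thesis using f' I by auto
qed

section \<open>Arboricity\<close>

text \<open>A component \<open>K\<close> of \<open>J\<close> spans at most
  \<open>t * (card K - 1)\<close> edges, and the numbers \<open>card K - 1\<close> add up to the
  rank.\<close>

lemma card_le_rk_if_sparse:
  assumes "finite_graph V J" "\<And>S. S \<subseteq> V \<Longrightarrow> S \<noteq> {} \<Longrightarrow> card {e\<in>J. e \<subseteq> S} \<le> t * (card S - 1)"
  shows "card J \<le> t * rk V J"
proof -
  let ?Q = "V // conn J"
  have fin: "finite V" "finite J" using finite_graphD[OF assms(1)] by auto
  have clV: "conn J `` {x} \<subseteq> V" if "x \<in> V" for x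
  proof
    fix y assume "y \<in> conn J `` {x}"
    then have "(x, y) \<in> conn J" by simp
    then show "y \<in> V" unfolding conn_def using that
      by (induction rule: rtrancl_induct) (use assms(1) in \<open>auto simp: finite_graph_def\<close>)
  qed
  have QV: "K \<subseteq> V \<and> K \<noteq> {}" if K: "K \<in> ?Q" for K
  proof -
    obtain x where x: "x \<in> V" "K = conn J `` {x}" using K by (elim quotientE)
    then have "x \<in> K" by simp
    then show ?thesis using clV x by blast
  qed
  have UQ: "\<Union>?Q = V"
  proof (intro equalityI subsetI)
    fix x assume "x \<in> V"
    then have "conn J `` {x} \<in> ?Q" "x \<in> conn J `` {x}" by (auto intro: quotientI)
    then show "x \<in> \<Union>?Q" by blast
  qed (use QV in blast)
  have finQ: "finite ?Q" unfolding quotient_def using fin by simp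
  have disjQ: "K \<inter> K' = {}" if "K \<in> ?Q" "K' \<in> ?Q" "K \<noteq> K'" for K K'
    using that by (auto simp: quotient_def)
      (metis (no_types, opaque_lifting) conn_class_eq_iff conn_sym conn_trans)+
  have "J = (\<Union>K\<in>?Q. {e\<in>J. e \<subseteq> K})"
  proof (intro equalityI subsetI)
    fix e assume "e \<in> J"
    then obtain u v where e: "e = {u, v}" "u \<in> V" using assms(1) by (metis finite_graph_edgeE)
    then have "e \<subseteq> conn J `` {u}" using \<open>e \<in> J\<close> conn_edge[of u v J] by auto
    moreover have "conn J `` {u} \<in> ?Q" using e(2) by (rule quotientI)
    ultimately show "e \<in> (\<Union>K\<in>?Q. {e\<in>J. e \<subseteq> K})" using \<open>e \<in> J\<close> by blast
  qed auto
  then have "card J = card (\<Union>K\<in>?Q. {e\<in>J. e \<subseteq> K})" by (rule arg_cong[where f = card])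
  also have "card (\<Union>K\<in>?Q. {e\<in>J. e \<subseteq> K}) \<le> (\<Sum>K\<in>?Q. card {e\<in>J. e \<subseteq> K})"
    using finQ by (rule card_UN_le)
  also have "\<dots> \<le> (\<Sum>K\<in>?Q. t * (card K - 1))"
    using QV by (intro sum_mono assms(2)) auto
  also have "\<dots> = t * (\<Sum>K\<in>?Q. card K - 1)" by (simp add: sum_distrib_left)
  \<comment> \<open>Components are nonempty, so the truncated subtraction is exact.\<close>
  also have "(\<Sum>K\<in>?Q. card K - 1) = (\<Sum>K\<in>?Q. card K) - (\<Sum>K\<in>?Q. 1)"
  proof (rule sum_subtractf_nat)
    fix K assume "K \<in> ?Q"
    then show "1 \<le> card K" using QV[of K] fin finite_subset[of K V] by (simp add: Suc_le_eq card_gt_0_iff)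
  qed
  also have "(\<Sum>K\<in>?Q. card K) = card (\<Union>?Q)"
  proof (intro card_Union_disjoint[symmetric])
    show "finite K" if "K \<in> ?Q" for K using QV[OF that] fin(1) finite_subset by blast
  qed (simp add: pairwise_def disjnt_def disjQ)
  finally show ?thesis by (simp add: UQ rk_def comps_def)
qed

text \<open>Rado's argument: shrink the colour lists one colour at a time. If neither of two
  colours can be dropped from a list, uncrossing the two violated inequalities contradicts
  submodularity.\<close>

lemma independent_list_colouring:
  fixes r :: "'e set \<Rightarrow> nat" and C :: "'e \<Rightarrow> nat set"
  assumes "finite E"
    and sub: "\<And>A B. A \<subseteq> E \<Longrightarrow> B \<subseteq> E \<Longrightarrow> r (A \<union> B) + r (A \<inter> B) \<le> r A + r B"
    and mono: "\<And>A B. A \<subseteq> B \<Longrightarrow> B \<subseteq> E \<Longrightarrow> r A \<le> r B"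
    and le: "\<And>A. A \<subseteq> E \<Longrightarrow> r A \<le> card A"
    and "\<And>e. e \<in> E \<Longrightarrow> C e \<subseteq> {..<t}"
    and "\<And>J. J \<subseteq> E \<Longrightarrow> card J \<le> (\<Sum>i<t. r {e\<in>J. i \<in> C e})"
  shows "\<exists>c. (\<forall>e\<in>E. c e < t) \<and> (\<forall>i<t. r {e\<in>E. c e = i} = card {e\<in>E. c e = i})"
  using assms(5,6)
proof (induction "\<Sum>e\<in>E. card (C e)" arbitrary: C rule: less_induct)
  case less
  show ?case
  proof (cases "\<exists>e0\<in>E. \<exists>i\<in>C e0. \<exists>j\<in>C e0. i \<noteq> j")
    case False
    have ex: "\<exists>i. C e = {i}" if "e \<in> E" for e
    proof -
      have "C e \<noteq> {}"
      proof
        assume "C e = {}"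
        then have "r {e'\<in>{e}. i \<in> C e'} = r {}" for i by (intro arg_cong[of _ _ r]) auto
        then have "(\<Sum>i<t. r {e'\<in>{e}. i \<in> C e'}) = 0" using le[of "{}"] by (simp del: singleton_iff)
        then show False using less.prems(2)[of "{e}"] that by simp
      qed
      then obtain i where "i \<in> C e" by auto
      then have "C e = {i}" using False that by blast
      then show ?thesis ..
    qed
    then obtain c where c: "\<And>e. e \<in> E \<Longrightarrow> C e = {c e}" by metis
    then have ct: "\<And>e. e \<in> E \<Longrightarrow> c e < t" using less.prems(1) by auto
    have eq: "{e\<in>E. i \<in> C e} = {e\<in>E. c e = i}" for i using c by auto
    have "card E = (\<Sum>i<t. card {e\<in>E. c e = i})"
      using sum_fun_comp[of E "{..<t}" c "\<lambda>_. 1::nat"] ct assms(1) by auto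
    moreover have "card E \<le> (\<Sum>i<t. r {e\<in>E. c e = i})" using less.prems(2)[of E] by (simp add: eq)
    moreover have rle: "r {e\<in>E. c e = i} \<le> card {e\<in>E. c e = i}" for i by (intro le) auto
    \<comment> \<open>No class has rank above its size and the sums agree, so every class has full
      rank.\<close>
    ultimately have "(\<Sum>i<t. r {e\<in>E. c e = i}) = (\<Sum>i<t. card {e\<in>E. c e = i})"
      by (metis (mono_tags, lifting) dual_order.antisym sum_mono)
    then have "\<forall>i\<in>{..<t}. r {e\<in>E. c e = i} = card {e\<in>E. c e = i}"
      using rle by (subst (asm) sum_mono_inv[symmetric]) (auto intro: sum_mono_inv)
    then show ?thesis using ct by (intro exI[of _ c]) auto
  next
    case True
    then obtain e0 i j where e0: "e0 \<in> E" "i \<in> C e0" "j \<in> C e0" "i \<noteq> j" by auto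
    let ?D = "\<lambda>x. C(e0 := C e0 - {x})"
    have IH: "?thesis" if "x \<in> C e0" and ok: "\<And>J. J \<subseteq> E \<Longrightarrow> card J \<le> (\<Sum>i<t. r {e\<in>J. i \<in> ?D x e})" for x
    proof (rule less.hyps[OF _ _ ok])
      have "finite (C e0)" using less.prems(1)[OF e0(1)] finite_subset by blast
      then have "card (C e0 - {x}) < card (C e0)" using that(1) by (rule card_Diff1_less)
      then show "(\<Sum>e\<in>E. card (?D x e)) < (\<Sum>e\<in>E. card (C e))"
        using assms(1) e0(1) by (intro sum_strict_mono_ex1) auto
    qed (use less.prems(1) e0(1) in \<open>auto split: if_splits\<close>)
    show ?thesis
    proof (rule ccontr)
      assume neg: "\<not> ?thesis"
      have viol: "\<exists>J\<subseteq>E. e0 \<in> J \<and> (\<Sum>l<t. r {e\<in>J. l \<in> ?D x e}) < card J" if x: "x \<in> C e0" for x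
      proof -
        have "\<exists>J\<subseteq>E. (\<Sum>l<t. r {e\<in>J. l \<in> ?D x e}) < card J"
        proof (rule ccontr)
          assume "\<not> (\<exists>J\<subseteq>E. (\<Sum>l<t. r {e\<in>J. l \<in> ?D x e}) < card J)"
          then have "card J \<le> (\<Sum>l<t. r {e\<in>J. l \<in> ?D x e})" if "J \<subseteq> E" for J
            using that not_le by blast
          then show False using IH[OF x] neg by blast
        qed
        then obtain J where J: "J \<subseteq> E" "(\<Sum>l<t. r {e\<in>J. l \<in> ?D x e}) < card J"
          by blast
        have "e0 \<in> J"
        proof (rule ccontr)
          assume "e0 \<notin> J"
          then have "{e\<in>J. l \<in> ?D x e} = {e\<in>J. l \<in> C e}" for l by auto
          then show False using J less.prems(2)[OF J(1)] by simp
        qed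
        then show ?thesis using J by blast
      qed
      obtain J1 J2 where J1: "J1 \<subseteq> E" "e0 \<in> J1" "(\<Sum>l<t. r {e\<in>J1. l \<in> ?D i e}) < card J1"
        and J2: "J2 \<subseteq> E" "e0 \<in> J2" "(\<Sum>l<t. r {e\<in>J2. l \<in> ?D j e}) < card J2"
        using viol[OF e0(2)] viol[OF e0(3)] by auto
      \<comment> \<open>Away from \<open>e0\<close> both reduced lists are the original ones, and at
        \<open>e0\<close> every colour survives in one of them because \<open>i \<noteq> j\<close>.
        So only the intersection has to give up \<open>e0\<close>, a loss of one against the two
        units gained from the two violations.\<close>
      let ?I = "J1 \<inter> J2 - {e0}"
      have un: "r {e\<in>J1 \<union> J2. l \<in> C e} + r {e\<in>?I. l \<in> C e}
          \<le> r {e\<in>J1. l \<in> ?D i e} + r {e\<in>J2. l \<in> ?D j e}" for l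
      proof -
        let ?A = "{e\<in>J1. l \<in> ?D i e}" and ?B = "{e\<in>J2. l \<in> ?D j e}"
        have "{e\<in>J1 \<union> J2. l \<in> C e} = ?A \<union> ?B" using J1(2) J2(2) e0(4) by auto
        moreover have "r {e\<in>?I. l \<in> C e} \<le> r (?A \<inter> ?B)" using J1(1) by (intro mono) auto
        moreover have "r (?A \<union> ?B) + r (?A \<inter> ?B) \<le> r ?A + r ?B"
          using J1(1) J2(1) by (intro sub) auto
        ultimately show ?thesis by simp
      qed
      have fin: "finite J1" "finite J2" using J1 J2 assms(1) finite_subset by auto
      have "card (J1 \<union> J2) + card ?I \<le> (\<Sum>l<t. r {e\<in>J1 \<union> J2. l \<in> C e}) + (\<Sum>l<t. r {e\<in>?I. l \<in> C e})"
        using J1 J2 by (intro add_mono less.prems(2)) auto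
      also have "\<dots> \<le> (\<Sum>l<t. r {e\<in>J1. l \<in> ?D i e}) + (\<Sum>l<t. r {e\<in>J2. l \<in> ?D j e})"
        unfolding sum.distrib[symmetric] by (intro sum_mono un)
      finally have le1: "card (J1 \<union> J2) + card ?I \<le> (\<Sum>l<t. r {e\<in>J1. l \<in> ?D i e}) + (\<Sum>l<t. r {e\<in>J2. l \<in> ?D j e})" .
      then have "card (J1 \<union> J2) + card ?I + 2 \<le> card J1 + card J2" using J1(3) J2(3) by linarith
      moreover have "card J1 + card J2 = card (J1 \<union> J2) + card (J1 \<inter> J2)"
        using fin by (rule card_Un_Int)
      moreover have "card (J1 \<inter> J2) = Suc (card ?I)"
        using fin J1 J2 by (metis IntI card.remove finite_Int)
      ultimately show False by linarith
    qed
  qed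
qed

section \<open>Forest colourings and the Nash-Williams formula\<close>

definition dense :: "'a set \<Rightarrow> 'a set set \<Rightarrow> nat \<Rightarrow> bool" where
  "dense V E t \<longleftrightarrow> (\<exists>S\<subseteq>V. S \<noteq> {} \<and> t * (card S - 1) < card {e\<in>E. e \<subseteq> S})"

definition forest_colourable :: "'a set set \<Rightarrow> nat \<Rightarrow> bool" where
  "forest_colourable E t \<longleftrightarrow> (\<exists>c. (\<forall>e\<in>E. c e < t) \<and> (\<forall>i<t. forest {e\<in>E. c e = i}))"

text \<open>The hard half of Nash-Williams: with all \<open>t\<close> colours on every list, Rado's
  condition becomes \<open>card J \<le> t * rk V J\<close>.\<close>

lemma forest_colourable_if_not_dense:
  assumes "finite_graph V E" "\<not> dense V E t"
  shows "forest_colourable E t"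
proof -
  have g: "F \<subseteq> E \<Longrightarrow> finite_graph V F" for F using assms(1) finite_graph_subset by blast
  have "\<exists>c. (\<forall>e\<in>E. c e < t) \<and> (\<forall>i<t. rk V {e\<in>E. c e = i} = card {e\<in>E. c e = i})"
  proof (rule independent_list_colouring[where C = "\<lambda>_. {..<t}"])
    show "finite E" using finite_graphD[OF assms(1)] by simp
    fix J assume J: "J \<subseteq> E"
    have "card J \<le> t * rk V J"
    proof (rule card_le_rk_if_sparse[OF g[OF J]])
      fix S assume "S \<subseteq> V" "S \<noteq> {}"
      then have "card {e\<in>E. e \<subseteq> S} \<le> t * (card S - 1)"
        using assms(2) by (auto simp: dense_def not_less)
      moreover have "card {e\<in>J. e \<subseteq> S} \<le> card {e\<in>E. e \<subseteq> S}"
        using J finite_graphD[OF assms(1)] by (intro card_mono) auto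
      ultimately show "card {e\<in>J. e \<subseteq> S} \<le> t * (card S - 1)" by simp
    qed
    then show "card J \<le> (\<Sum>i<t. rk V {e\<in>J. i \<in> {..<t}})" by simp
  qed (simp_all add: rk_submodular rk_mono rk_le_card g)
  then obtain c where c: "\<And>e. e \<in> E \<Longrightarrow> c e < t" "\<And>i. i < t \<Longrightarrow> rk V {e\<in>E. c e = i} = card {e\<in>E. c e = i}"
    by blast
  have "forest {e\<in>E. c e = i}" if "i < t" for i
    using forest_iff_rk[OF g, of "{e\<in>E. c e = i}"] c(2)[OF that] by blast
  then show ?thesis unfolding forest_colourable_def using c(1) by blast
qed

lemma forest_card_le:
  assumes "finite_graph S F" "S \<noteq> {}" "forest F"
  shows "card F \<le> card S - 1"
proof -
  have "card F = rk S F" using forest_iff_rk[OF assms(1)] assms(3) by simp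
  moreover have "0 < comps S F" using assms(1,2) finite_graphD comps_pos by blast
  ultimately show ?thesis by (simp add: rk_def)
qed

lemma forest_colourable_card_le:
  assumes "finite_graph V E" "forest_colourable E t" "S \<subseteq> V" "S \<noteq> {}"
  shows "card {e\<in>E. e \<subseteq> S} \<le> t * (card S - 1)"
proof -
  obtain c where c: "\<And>e. e \<in> E \<Longrightarrow> c e < t" "\<And>i. i < t \<Longrightarrow> forest {e\<in>E. c e = i}"
    using assms(2) unfolding forest_colourable_def by blast
  have "{e\<in>E. e \<subseteq> S} = (\<Union>i<t. {e\<in>E. c e = i \<and> e \<subseteq> S})" using c(1) by auto
  then have "card {e\<in>E. e \<subseteq> S} \<le> (\<Sum>i<t. card {e\<in>E. c e = i \<and> e \<subseteq> S})"
    by (simp add: card_UN_le)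
  also have "\<dots> \<le> (\<Sum>i<t. card S - 1)"
  proof (rule sum_mono)
    fix i assume "i \<in> {..<t}"
    then have "forest {e\<in>E. c e = i \<and> e \<subseteq> S}" by (intro forest_subset[OF c(2)[of i]]) auto
    then show "card {e\<in>E. c e = i \<and> e \<subseteq> S} \<le> card S - 1"
      using assms by (intro forest_card_le) (auto simp: finite_graph_def intro: finite_subset)
  qed
  finally show ?thesis by simp
qed

lemma forest_colourable_if_arboricity_le:
  assumes "finite_graph V E" "arboricity E \<le> t"
  shows "forest_colourable E t"
proof -
  have fin: "finite E" using finite_graphD[OF assms(1)] by simp
  have single: "forest {e}" for e :: "'a set"
  proof -
    have "\<not> is_cycle {e} vs" for vs
    proof
      assume cyc: "is_cycle {e} vs"
      then have len: "3 \<le> length vs" and ed: "\<And>i. i < length vs \<Longrightarrow> {vs ! i, vs ! (Suc i mod length vs)} = e"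
        unfolding is_cycle_def by blast+
      have len01: "0 < length vs" "1 < length vs" using len by linarith+
      have "{vs ! 0, vs ! (Suc 0 mod length vs)} = {vs ! 1, vs ! (Suc 1 mod length vs)}"
        using ed[of 0] ed[of 1] len01 by metis
      then have "(0::nat) = 1" by (rule cycle_edges_distinct[OF cyc len01])
      then show False by simp
    qed
    then show ?thesis by (auto simp: forest_def)
  qed
  \<comment> \<open>The singletons are such a partition, so the minimum in \<open>arboricity\<close>
    is attained.\<close>
  have "\<exists>n P. partition_on E P \<and> finite P \<and> card P = n \<and> (\<forall>F\<in>P. forest F)"
    using fin single by (intro exI[of _ "(\<lambda>e. {e}) ` E"] exI) (auto intro!: partition_onI simp: disjnt_def)
  then have "\<exists>P. partition_on E P \<and> finite P \<and> card P = arboricity E \<and> (\<forall>F\<in>P. forest F)"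
    unfolding arboricity_def by (rule LeastI_ex)
  then obtain P where P: "partition_on E P" "finite P" "card P \<le> t" "\<And>F. F \<in> P \<Longrightarrow> forest F"
    using assms(2) by auto
  obtain g where g: "inj_on g P" "g ` P \<subseteq> {..<t}"
    using card_le_inj[of P "{..<t}"] P by auto
  define cl where "cl e = (THE F. F \<in> P \<and> e \<in> F)" for e
  have cl: "cl e = F" if "F \<in> P" "e \<in> F" for e F
    unfolding cl_def using that P(1)
    by (intro the_equality) (auto simp: partition_on_def disjoint_def)
  have clP: "cl e \<in> P \<and> e \<in> cl e" if "e \<in> E" for e
    using that P(1) cl by (auto simp: partition_on_def)
  have "forest {e\<in>E. g (cl e) = i}" for i
  proof (cases "\<exists>e\<in>E. g (cl e) = i")
    case True
    then obtain e0 where e0: "e0 \<in> E" "g (cl e0) = i" by auto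
    have "{e\<in>E. g (cl e) = i} \<subseteq> cl e0" using e0 g(1) clP by (auto dest!: inj_onD)
    then show ?thesis using P(4) clP e0 forest_subset by blast
  next
    case False
    then have "{e\<in>E. g (cl e) = i} = {}" by auto
    then show ?thesis by (metis forest_empty)
  qed
  then show ?thesis
    unfolding forest_colourable_def using clP g(2) by (intro exI[of _ "\<lambda>e. g (cl e)"]) auto
qed

lemma arboricity_le_if_forest_colourable:
  assumes "forest_colourable E t"
  shows "arboricity E \<le> t"
proof -
  obtain c where c: "\<And>e. e \<in> E \<Longrightarrow> c e < t" "\<And>i. i < t \<Longrightarrow> forest {e\<in>E. c e = i}"
    using assms by (auto simp: forest_colourable_def)
  let ?P = "(\<lambda>i. {e\<in>E. c e = i}) ` {..<t} - {{}}"
  have "partition_on E ?P" using c(1) by (intro partition_onI) (auto simp: disjnt_def)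
  moreover have "finite ?P" by simp
  moreover have "\<forall>F\<in>?P. forest F" using c(2) by auto
  ultimately have "arboricity E \<le> card ?P" unfolding arboricity_def by (intro Least_le) blast
  also have "\<dots> \<le> card ((\<lambda>i. {e\<in>E. c e = i}) ` {..<t})" by (intro card_mono) auto
  also have "\<dots> \<le> t" using card_image_le[of "{..<t}" "\<lambda>i. {e\<in>E. c e = i}"] by simp
  finally show ?thesis .
qed

lemma nash_williams:
  assumes "finite_graph V E"
  shows "arboricity E \<le> t \<longleftrightarrow> \<not> dense V E t"
proof
  assume "arboricity E \<le> t"
  then show "\<not> dense V E t"
    using forest_colourable_card_le[OF assms forest_colourable_if_arboricity_le[OF assms]]
    by (auto simp: dense_def not_less)
qed (simp add: arboricity_le_if_forest_colourable forest_colourable_if_not_dense[OF assms])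

section \<open>The game\<close>

lemma maker_part_snoc:
  "maker_part (h @ [e]) = (if even (length h) then insert e (maker_part h) else maker_part h)"
proof -
  have "{(h @ [e]) ! i | i. i < length h \<and> even i} = maker_part h"
    by (auto simp: maker_part_def nth_append)
  moreover have "{(h @ [e]) ! i | i. i = length h \<and> even i} = (if even (length h) then {e} else {})"
    by auto
  moreover have "maker_part (h @ [e]) =
      {(h @ [e]) ! i | i. i < length h \<and> even i} \<union> {(h @ [e]) ! i | i. i = length h \<and> even i}"
    unfolding maker_part_def length_append_singleton less_Suc_eq by blast
  ultimately show ?thesis by simp
qed

lemma maker_part_subset: "maker_part h \<subseteq> set h"
  by (auto simp: maker_part_def)

lemma follows_strategy_snoc:
  "follows_strategy \<sigma> (h @ [e]) \<longleftrightarrow> follows_strategy \<sigma> h \<and> (even (length h) \<longrightarrow> e = \<sigma> h)"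
  by (auto simp: follows_strategy_def less_Suc_eq nth_append)

text \<open>Maker always answers inside \<open>H\<close>, so each of Breaker's elements of \<open>H\<close> is
  immediately preceded by one of Maker's.\<close>

lemma maker_takes_half:
  assumes "finite X" "H \<subseteq> X"
  shows "\<exists>\<sigma>. maker_strategy X \<sigma> \<and>
    (\<forall>p. complete_play X p \<and> follows_strategy \<sigma> p \<longrightarrow> card H \<le> 2 * card (maker_part p \<inter> H))"
proof -
  define \<sigma> where "\<sigma> h = (if H - set h \<noteq> {} then SOME x. x \<in> H - set h else SOME x. x \<in> X - set h)" for h
  have \<sigma>H: "\<sigma> h \<in> H - set h" if "H - set h \<noteq> {}" for h
    using that some_in_eq[of "H - set h"] by (simp add: \<sigma>_def)
  have \<sigma>X: "\<sigma> h \<in> X - set h" if "X - set h \<noteq> {}" for h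
  proof (cases "H - set h = {}")
    case True
    then show ?thesis using that some_in_eq[of "X - set h"] by (simp add: \<sigma>_def)
  next
    case False
    then show ?thesis using \<sigma>H assms(2) by blast
  qed
  have "maker_strategy X \<sigma>" unfolding maker_strategy_def using \<sigma>X by blast
  moreover have "card H \<le> 2 * card (maker_part p \<inter> H)"
    if p: "complete_play X p" "follows_strategy \<sigma> p" for p
  proof -
    have d: "distinct p" "set p = X" using p(1) by (auto simp: complete_play_def)
    have finH: "finite H" using assms finite_subset by blast
    have step: "p ! i \<in> H" if "Suc i < length p" "even i" "p ! Suc i \<in> H" for i
    proof -
      have "p ! Suc i \<notin> set (take i p)"
        using that(1) d(1) by (auto simp: in_set_conv_nth nth_eq_iff_index_eq)
      then have "\<sigma> (take i p) \<in> H" using \<sigma>H[of "take i p"] that(3) by blast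
      then show ?thesis using p(2) that by (simp add: follows_strategy_def)
    qed
    let ?I = "{i. i < length p \<and> even i \<and> p ! i \<in> H}"
    have M: "maker_part p \<inter> H = (!) p ` ?I" by (auto simp: maker_part_def)
    have "H \<subseteq> (!) p ` ?I \<union> (\<lambda>i. p ! Suc i) ` ?I"
    proof
      fix x assume x: "x \<in> H"
      then obtain j where j: "j < length p" "p ! j = x" using assms(2) d(2) by (metis in_set_conv_nth subsetD)
      show "x \<in> (!) p ` ?I \<union> (\<lambda>i. p ! Suc i) ` ?I"
      proof (cases "even j")
        case True
        then show ?thesis using j x by auto
      next
        case False
        then obtain i where i: "j = Suc i" "even i" by (metis even_Suc not0_implies_Suc even_zero)
        then have "i \<in> ?I" using step[of i] j x by auto
        then show ?thesis using j i by auto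
      qed
    qed
    then have "card H \<le> card ((!) p ` ?I \<union> (\<lambda>i. p ! Suc i) ` ?I)" by (intro card_mono) auto
    also have "\<dots> \<le> card ((!) p ` ?I) + card ((\<lambda>i. p ! Suc i) ` ?I)" by (rule card_Un_le)
    also have "card ((\<lambda>i. p ! Suc i) ` ?I) \<le> card ?I" by (intro card_image_le) auto
    also have "card ?I = card ((!) p ` ?I)"
      using d(1) by (intro card_image[symmetric] inj_onI) (auto simp: nth_eq_iff_index_eq)
    finally show ?thesis unfolding M by simp
  qed
  ultimately show ?thesis by blast
qed

text \<open>Breaker's invariant, where \<open>m\<close> and \<open>b\<close> are the edges claimed by Maker and Breaker.\<close>

definition paired :: "nat \<Rightarrow> (nat \<Rightarrow> 'a set set) \<Rightarrow> 'a set set \<Rightarrow> 'a set set \<Rightarrow> bool" where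
  "paired n X m b \<longleftrightarrow> (\<forall>q<n. \<exists>A B. forest A \<and> forest B \<and> m \<inter> X q \<subseteq> A \<inter> B \<and> A \<union> B = X q - b)"

text \<open>With \<open>e\<close> in \<open>A\<close>, Breaker needs \<open>e\<close> in
  \<open>B\<close> as well. If it fits there, any free edge may be given up; otherwise the exchange
  names the edge to claim.\<close>

lemma paired_reply:
  assumes "finite_graph V E" "\<And>q. q < n \<Longrightarrow> X q \<subseteq> E" "disjoint_family_on X {..<n}"
    and "paired n X m b" "e \<in> E - b" "E \<subseteq> (\<Union>q<n. X q)" "m \<inter> b = {}"
    and ne: "E - m - b - {e} \<noteq> {}"
  shows "\<exists>f\<in>E - m - b - {e}. paired n X (insert e m) (insert f b)"
proof -
  obtain q0 where q0: "q0 < n" "e \<in> X q0" using assms(5,6) by blast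
  have other: "e \<notin> X q" if "q < n" "q \<noteq> q0" for q
    using that q0 assms(3) by (auto simp: disjoint_family_on_def)
  obtain A0 B0 where AB0: "forest A0" "forest B0" "m \<inter> X q0 \<subseteq> A0 \<inter> B0" "A0 \<union> B0 = X q0 - b"
    using assms(4) q0(1) by (auto simp: paired_def)
  have "\<exists>A B. forest A \<and> forest B \<and> m \<inter> X q0 \<subseteq> A \<inter> B \<and> A \<union> B = X q0 - b \<and> e \<in> A"
  proof (cases "e \<in> A0")
    case True
    then show ?thesis using AB0 by blast
  next
    case False
    then have "e \<in> B0" using AB0 q0(2) assms(5) by blast
    then show ?thesis using AB0 by (intro exI[of _ B0] exI[of _ A0]) blast
  qed
  then obtain A B where A: "forest A" and B: "forest B" and mAB: "m \<inter> X q0 \<subseteq> A \<inter> B"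
    and AB: "A \<union> B = X q0 - b" and eA: "e \<in> A" by blast
  have "\<exists>f\<in>E - m - b - {e}. \<exists>A' B'. forest A' \<and> forest B' \<and> insert e m \<inter> X q0 \<subseteq> A' \<inter> B' \<and>
      A' \<union> B' = X q0 - insert f b"
  proof (cases "forest (insert e B)")
    case True
    obtain f where f: "f \<in> E - m - b - {e}" using ne by blast
    have "forest (A - {f})" "forest (insert e B - {f})"
      using A True by (auto intro: forest_subset)
    moreover have "insert e m \<inter> X q0 \<subseteq> (A - {f}) \<inter> (insert e B - {f})"
      using mAB eA f by blast
    moreover have "(A - {f}) \<union> (insert e B - {f}) = X q0 - insert f b" using AB eA by blast
    ultimately show ?thesis using f by blast
  next
    case False
    have "finite_graph V A" "finite_graph V B"
      using AB assms(2)[OF q0(1)] by (auto intro!: finite_graph_subset[OF assms(1)])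
    then obtain f where f: "f \<in> B - A" "forest (insert e (B - {f}))"
      using forest_exchange[OF _ _ A B eA False] by blast
    \<comment> \<open>\<open>f\<close> is free: it lies in \<open>B\<close>, hence outside
      \<open>b\<close>, and it lies outside \<open>A\<close>, which contains \<open>e\<close> and
      Maker's edges of this pair.\<close>
    then have "f \<in> E - m - b - {e}" using AB mAB eA assms(2)[OF q0(1)] by blast
    moreover have "insert e m \<inter> X q0 \<subseteq> A \<inter> insert e (B - {f})"
      using mAB eA f by blast
    moreover have "A \<union> insert e (B - {f}) = X q0 - insert f b" using AB eA f by blast
    ultimately show ?thesis using A f(2) by blast
  qed
  then obtain f where f: "f \<in> E - m - b - {e}"
    and f0: "\<exists>A' B'. forest A' \<and> forest B' \<and> insert e m \<inter> X q0 \<subseteq> A' \<inter> B' \<and> A' \<union> B' = X q0 - insert f b"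
    by blast
  have "paired n X (insert e m) (insert f b)"
    unfolding paired_def
  proof (intro allI impI)
    fix q assume q: "q < n"
    show "\<exists>A B. forest A \<and> forest B \<and> insert e m \<inter> X q \<subseteq> A \<inter> B \<and> A \<union> B = X q - insert f b"
    proof (cases "q = q0")
      case True
      then show ?thesis using f0 by simp
    next
      case False
      obtain A B where "forest A" "forest B" "m \<inter> X q \<subseteq> A \<inter> B" "A \<union> B = X q - b"
        using assms(4) q by (auto simp: paired_def)
      then have "forest (A - {f})" "forest (B - {f})" "insert e m \<inter> X q \<subseteq> (A - {f}) \<inter> (B - {f})"
        "(A - {f}) \<union> (B - {f}) = X q - insert f b"
        using other[OF q False] f by (auto intro: forest_subset)
      then show ?thesis by blast
    qed
  qed
  then show ?thesis using f by blast
qed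

text \<open>To refute a fixed Maker strategy one play suffices, so the replies are chosen along the
  way and no strategy for Breaker is defined. The induction runs over histories of even length,
  where Maker is to move.\<close>

lemma breaker_play:
  assumes "finite_graph V E" "\<And>q. q < n \<Longrightarrow> X q \<subseteq> E" "disjoint_family_on X {..<n}"
    "E \<subseteq> (\<Union>q<n. X q)" "maker_strategy E \<sigma>"
    and "distinct h" "set h \<subseteq> E" "even (length h)" "follows_strategy \<sigma> h"
    and "paired n X (maker_part h) (set h - maker_part h)"
  shows "\<exists>p. complete_play E p \<and> follows_strategy \<sigma> p \<and> (\<forall>q<n. forest (maker_part p \<inter> X q))"
  using assms(6-)
proof (induction "card (E - set h)" arbitrary: h rule: less_induct)
  case less
  let ?m = "maker_part h" and ?b = "set h - maker_part h"
  have finE: "finite E" using finite_graphD[OF assms(1)] by simp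
  show ?case
  proof (cases "set h = E")
    case True
    have "forest (?m \<inter> X q)" if "q < n" for q
      using less.prems(5) that forest_subset unfolding paired_def by (metis le_infE)
    then show ?thesis using less.prems True by (intro exI[of _ h]) (auto simp: complete_play_def)
  next
    case False
    define e where "e = \<sigma> h"
    have e: "e \<in> E - set h"
      using assms(5) less.prems False by (auto simp: maker_strategy_def e_def)
    have fe: "follows_strategy \<sigma> (h @ [e])" using less.prems by (simp add: follows_strategy_snoc e_def)
    have me: "maker_part (h @ [e]) = insert e ?m" using less.prems by (simp add: maker_part_snoc)
    show ?thesis
    proof (cases "E - set h - {e} = {}")
      case True
      \<comment> \<open>Maker takes the last edge and there is no reply: \<open>e\<close> lies in
        one forest of its pair, and that forest already contains her other edges of the
        pair.\<close>
      have "forest (insert e ?m \<inter> X q)" if q: "q < n" for q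
      proof -
        obtain A B where AB: "forest A" "forest B" "?m \<inter> X q \<subseteq> A \<inter> B" "A \<union> B = X q - ?b"
          using less.prems(5) q by (auto simp: paired_def)
        have "insert e ?m \<inter> X q \<subseteq> A \<or> insert e ?m \<inter> X q \<subseteq> B"
        proof (cases "e \<in> X q")
          case True
          then have "e \<in> A \<union> B" using AB(4) e by blast
          then show ?thesis using AB(3) by blast
        qed (use AB(3) in blast)
        then show ?thesis using AB forest_subset by blast
      qed
      moreover have "complete_play E (h @ [e])"
        using True e less.prems by (auto simp: complete_play_def)
      ultimately show ?thesis using fe me by (intro exI[of _ "h @ [e]"]) simp
    next
      case ne: False
      have un: "E - ?m - ?b - {e} = E - set h - {e}" using maker_part_subset[of h] by blast
      have "\<exists>f\<in>E - ?m - ?b - {e}. paired n X (insert e ?m) (insert f ?b)"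
      proof (rule paired_reply[OF assms(1,2,3) less.prems(5) _ assms(4)])
        show "E - ?m - ?b - {e} \<noteq> {}" using ne un by simp
      qed (use e in auto)
      then obtain f where f: "f \<in> E - set h - {e}" "paired n X (insert e ?m) (insert f ?b)"
        unfolding un by blast
      let ?h = "h @ [e, f]"
      have m': "maker_part ?h = insert e ?m"
        using maker_part_snoc[of "h @ [e]" f] me less.prems(3) by simp
      have "set ?h - maker_part ?h = insert f ?b"
        unfolding m' using e f(1) maker_part_subset[of h] by auto
      then have A: "paired n X (maker_part ?h) (set ?h - maker_part ?h)" using f(2) m' by simp
      have B: "follows_strategy \<sigma> ?h"
        using follows_strategy_snoc[of \<sigma> "h @ [e]" f] fe less.prems(3) by simp
      have C: "card (E - set ?h) < card (E - set h)"
        using e f(1) finE by (intro psubset_card_mono) auto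
      have "f \<noteq> e" using f(1) by blast
      then have D: "distinct ?h" using less.prems(1) e f(1) by simp
      have "set ?h \<subseteq> E" "even (length ?h)" using less.prems(2,3) e f(1) by simp_all
      then show ?thesis by (intro less.hyps[OF C D _ _ B A])
    qed
  qed
qed

lemma maker_wins_arboricity_iff_dense:
  assumes "finite_graph V E" "2 \<le> k"
  shows "maker_wins_arboricity k E \<longleftrightarrow> dense V E (2 * k - 2)"
proof
  assume "dense V E (2 * k - 2)"
  then obtain S where S: "S \<subseteq> V" "S \<noteq> {}" "(2 * k - 2) * (card S - 1) < card {e\<in>E. e \<subseteq> S}"
    by (auto simp: dense_def)
  let ?H = "{e\<in>E. e \<subseteq> S}"
  obtain \<sigma> where \<sigma>: "maker_strategy E \<sigma>"
    "\<And>p. complete_play E p \<Longrightarrow> follows_strategy \<sigma> p \<Longrightarrow> card ?H \<le> 2 * card (maker_part p \<inter> ?H)"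
    using maker_takes_half[of E ?H] finite_graphD[OF assms(1)] by auto
  have "k \<le> arboricity (maker_part p)" if p: "complete_play E p" "follows_strategy \<sigma> p" for p
  proof (rule ccontr)
    assume "\<not> k \<le> arboricity (maker_part p)"
    then have "arboricity (maker_part p) \<le> k - 1" by simp
    moreover have sub: "maker_part p \<subseteq> E"
      using p(1) maker_part_subset[of p] by (auto simp: complete_play_def)
    note g = finite_graph_subset[OF assms(1) sub]
    ultimately have "forest_colourable (maker_part p) (k - 1)"
      using forest_colourable_if_arboricity_le by blast
    then have "card {e\<in>maker_part p. e \<subseteq> S} \<le> (k - 1) * (card S - 1)"
      using S by (intro forest_colourable_card_le[OF g]) auto
    moreover have "{e\<in>maker_part p. e \<subseteq> S} = maker_part p \<inter> ?H" using sub by blast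
    ultimately have H: "card ?H \<le> 2 * ((k - 1) * (card S - 1))" using \<sigma>(2)[OF p] by simp
    have eq: "2 * k - 2 = 2 * (k - 1)" by simp
    show False using H S(3) unfolding eq mult.assoc by linarith
  qed
  then show "maker_wins_arboricity k E"
    unfolding maker_wins_arboricity_def maker_has_winning_strategy_def using \<sigma>(1) by blast
next
  assume win: "maker_wins_arboricity k E"
  show "dense V E (2 * k - 2)"
  proof (rule ccontr)
    assume "\<not> dense V E (2 * k - 2)"
    then have "forest_colourable E (2 * k - 2)" by (rule forest_colourable_if_not_dense[OF assms(1)])
    then obtain c where c: "\<And>e. e \<in> E \<Longrightarrow> c e < 2 * k - 2"
      "\<And>i. i < 2 * k - 2 \<Longrightarrow> forest {e\<in>E. c e = i}"
      unfolding forest_colourable_def by blast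
    \<comment> \<open>The colours \<open>2 * q\<close> and \<open>2 * q + 1\<close> form the pair
      \<open>q\<close>.\<close>
    define X where "X q = {e\<in>E. c e div 2 = q}" for q
    obtain \<sigma> where \<sigma>: "maker_strategy E \<sigma>"
      "\<And>p. complete_play E p \<Longrightarrow> follows_strategy \<sigma> p \<Longrightarrow> k \<le> arboricity (maker_part p)"
      using win unfolding maker_wins_arboricity_def maker_has_winning_strategy_def by blast
    have cov: "E \<subseteq> (\<Union>q<k - 1. X q)"
    proof
      fix e assume e: "e \<in> E"
      then have "c e div 2 < k - 1" using c(1)[OF e] by linarith
      then show "e \<in> (\<Union>q<k - 1. X q)" using e by (auto simp: X_def)
    qed
    have "\<exists>p. complete_play E p \<and> follows_strategy \<sigma> p \<and> (\<forall>q<k - 1. forest (maker_part p \<inter> X q))"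
    proof (rule breaker_play[OF assms(1) _ _ cov \<sigma>(1), of "[]"])
      show "disjoint_family_on X {..<k - 1}" by (auto simp: disjoint_family_on_def X_def)
      show "paired (k - 1) X (maker_part []) (set [] - maker_part [])"
        unfolding paired_def
      proof (intro allI impI)
        fix q assume q: "q < k - 1"
        have "X q = {e\<in>E. c e = 2 * q} \<union> {e\<in>E. c e = 2 * q + 1}" by (auto simp: X_def)
        then show "\<exists>A B. forest A \<and> forest B \<and> maker_part [] \<inter> X q \<subseteq> A \<inter> B \<and>
            A \<union> B = X q - (set [] - maker_part [])"
          using c(2)[of "2 * q"] c(2)[of "2 * q + 1"] q
          by (intro exI[of _ "{e\<in>E. c e = 2 * q}"] exI[of _ "{e\<in>E. c e = 2 * q + 1}"])
            (simp add: maker_part_def)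
      qed
    qed (auto simp: X_def follows_strategy_def)
    then obtain p where p: "complete_play E p" "follows_strategy \<sigma> p"
      "\<And>q. q < k - 1 \<Longrightarrow> forest (maker_part p \<inter> X q)" by blast
    have sub: "maker_part p \<subseteq> E"
      using p(1) maker_part_subset[of p] by (auto simp: complete_play_def)
    have "forest_colourable (maker_part p) (k - 1)"
      unfolding forest_colourable_def
    proof (intro exI[of _ "\<lambda>e. c e div 2"] conjI ballI allI impI)
      show "c e div 2 < k - 1" if "e \<in> maker_part p" for e
        using that sub c(1)[of e] by (auto simp: less_mult_imp_div_less)
      have "{e\<in>maker_part p. c e div 2 = i} = maker_part p \<inter> X i" for i
        using sub by (auto simp: X_def)
      then show "forest {e\<in>maker_part p. c e div 2 = i}" if "i < k - 1" for i
        using p(3)[OF that] by simp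
    qed
    then have "arboricity (maker_part p) \<le> k - 1" by (rule arboricity_le_if_forest_colourable)
    then show False using \<sigma>(2)[OF p(1,2)] assms(2) by simp
  qed
qed

lemma maker_wins_arboricity_iff:
  assumes "finite_graph V E" "2 \<le> k"
  shows "maker_wins_arboricity k E \<longleftrightarrow> int k \<le> \<lceil>real (arboricity E) / 2\<rceil>"
proof -
  have "maker_wins_arboricity k E \<longleftrightarrow> \<not> arboricity E \<le> 2 * k - 2"
    using maker_wins_arboricity_iff_dense[OF assms] nash_williams[OF assms(1)] by simp
  \<comment> \<open>The ceiling reaches \<open>k\<close> as soon as half the arboricity exceeds
    \<open>k - 1\<close>.\<close>
  also have "\<dots> \<longleftrightarrow> int k \<le> \<lceil>real (arboricity E) / 2\<rceil>"
    using assms(2) by (simp add: le_ceiling_iff) linarith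
  finally show ?thesis .
qed

section \<open>Timed program logic\<close>

fun writes :: "com \<Rightarrow> nat set" where
  "writes (Const i n) = {i}"
| "writes (Add i j l) = {i}"
| "writes (Sub i j l) = {i}"
| "writes (Load i j) = {i}"
| "writes (Store i j) = {}"
| "writes (Seq c d) = writes c \<union> writes d"
| "writes (If i c d) = writes c \<union> writes d"
| "writes (While i c) = writes c"

fun storeless :: "com \<Rightarrow> bool" where
  "storeless (Store i j) \<longleftrightarrow> False"
| "storeless (Seq c d) \<longleftrightarrow> storeless c \<and> storeless d"
| "storeless (If i c d) \<longleftrightarrow> storeless c \<and> storeless d"
| "storeless (While i c) \<longleftrightarrow> storeless c"
| "storeless c \<longleftrightarrow> True"

text \<open>An upper bound on the running time when each loop is iterated at most \<open>B\<close> times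
  whenever it is entered.\<close>

fun steps :: "nat \<Rightarrow> com \<Rightarrow> nat" where
  "steps B (Seq c d) = steps B c + steps B d"
| "steps B (If i c d) = Suc (steps B c + steps B d)"
| "steps B (While i c) = Suc (B * Suc (steps B c))"
| "steps B c = 1"

lemma steps_poly: "\<exists>p. \<forall>B. steps B c = poly p B"
proof (induction c)
  case (Seq c d)
  then obtain p q where "\<forall>B. steps B c = poly p B" "\<forall>B. steps B d = poly q B" by blast
  then show ?case by (intro exI[of _ "p + q"]) simp
next
  case (If i c d)
  then obtain p q where "\<forall>B. steps B c = poly p B" "\<forall>B. steps B d = poly q B" by blast
  then show ?case by (intro exI[of _ "1 + p + q"]) simp
next
  case (While i c)
  then obtain p where "\<forall>B. steps B c = poly p B" by blast
  then show ?case by (intro exI[of _ "1 + [:0, 1:] * (1 + p)"]) simp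
qed (auto intro: exI[of _ 1])

text \<open>Total correctness with a time bound. The postcondition is an argument, so the rules
  below compute preconditions backwards; the bound is syntactic, so time need not be carried through
  the proofs about programs.\<close>

definition runs :: "nat \<Rightarrow> com \<Rightarrow> (nat \<Rightarrow> nat) \<Rightarrow> (nat \<Rightarrow> nat) \<Rightarrow>
    ((nat \<Rightarrow> nat) \<Rightarrow> (nat \<Rightarrow> nat) \<Rightarrow> bool) \<Rightarrow> bool" where
  "runs B c R M Q \<longleftrightarrow> (\<exists>t R' M'. exec c (R, M) t (R', M') \<and> t \<le> steps B c \<and> Q R' M')"

lemma exec_frame: "exec c s t s' \<Longrightarrow> x \<notin> writes c \<Longrightarrow> fst s' x = fst s x"
  by (induction rule: exec.induct) auto

lemma exec_storeless: "exec c s t s' \<Longrightarrow> storeless c \<Longrightarrow> snd s' = snd s"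
  by (induction rule: exec.induct) auto

text \<open>The consequence rule also hands over the frame: unwritten registers, and the memory of a
  program without stores. Postconditions therefore state only what a program computes.\<close>

lemma runs_mono:
  assumes "runs B c R M Q"
    and "\<And>R' M'. Q R' M' \<Longrightarrow> (\<And>x. x \<notin> writes c \<Longrightarrow> R' x = R x) \<Longrightarrow>
      (storeless c \<Longrightarrow> M' = M) \<Longrightarrow> Q' R' M'"
  shows "runs B c R M Q'"
proof -
  obtain t R' M' where ex: "exec c (R, M) t (R', M')" "t \<le> steps B c" "Q R' M'"
    using assms(1) unfolding runs_def by blast
  have "Q' R' M'" using exec_frame[OF ex(1)] exec_storeless[OF ex(1)] by (intro assms(2) ex(3)) simp_all
  then show ?thesis using ex unfolding runs_def by blast
qed

lemma runs_Const: "Q (R(i := n)) M \<Longrightarrow> runs B (Const i n) R M Q"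
  and runs_Add: "Q (R(i := R j + R l)) M \<Longrightarrow> runs B (Add i j l) R M Q"
  and runs_Sub: "Q (R(i := R j - R l)) M \<Longrightarrow> runs B (Sub i j l) R M Q"
  and runs_Load: "Q (R(i := M (R j))) M \<Longrightarrow> runs B (Load i j) R M Q"
  and runs_Store: "Q R (M(R i := R j)) \<Longrightarrow> runs B (Store i j) R M Q"
  unfolding runs_def
  by (rule exI[of _ 1], intro exI conjI, (rule exec.intros | assumption | simp)+)+

lemma runs_Seq: "runs B c R M (\<lambda>R' M'. runs B d R' M' Q) \<Longrightarrow> runs B (Seq c d) R M Q"
  unfolding runs_def by (auto intro!: add_mono) (metis add_mono exec.Seq)

lemma runs_If:
  assumes "R i \<noteq> 0 \<Longrightarrow> runs B c R M Q" "R i = 0 \<Longrightarrow> runs B d R M Q"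
  shows "runs B (If i c d) R M Q"
proof (cases "R i = 0")
  case True
  then obtain t R' M' where "exec d (R, M) t (R', M')" "t \<le> steps B d" "Q R' M'"
    using assms(2) unfolding runs_def by blast
  then show ?thesis unfolding runs_def
    by (intro exI[of _ "Suc t"] exI[of _ R'] exI[of _ M']) (simp add: exec.If_False[of R i, OF True])
next
  case False
  then obtain t R' M' where "exec c (R, M) t (R', M')" "t \<le> steps B c" "Q R' M'"
    using assms(1) unfolding runs_def by blast
  then show ?thesis unfolding runs_def
    by (intro exI[of _ "Suc t"] exI[of _ R'] exI[of _ M']) (simp add: exec.If_True[of R i, OF False])
qed

text \<open>\<open>f\<close> is a variant that starts at no more than \<open>B\<close>; it bounds
  the iterations of one run of the loop, which is what \<open>steps\<close> charges for.\<close>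

lemma runs_While:
  assumes "P R M" "f R M \<le> B"
    and step: "\<And>R M. P R M \<Longrightarrow> R i \<noteq> 0 \<Longrightarrow> runs B c R M (\<lambda>R' M'. P R' M' \<and> f R' M' < (f R M :: nat))"
    and post: "\<And>R M. P R M \<Longrightarrow> R i = 0 \<Longrightarrow> Q R M"
  shows "runs B (While i c) R M Q"
proof -
  have "\<exists>t R' M'. exec (While i c) (R, M) t (R', M') \<and> t \<le> Suc (f R M * Suc (steps B c)) \<and> Q R' M'"
    using assms(1)
  proof (induction "f R M" arbitrary: R M rule: less_induct)
    case less
    show ?case
    proof (cases "R i = 0")
      case True
      then show ?thesis using post[OF less.prems True] exec.While_False[of R i c M, OF True]
        by (intro exI[of _ 1] exI[of _ R] exI[of _ M]) simp
    next
      case False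
      obtain t R1 M1 where 1: "exec c (R, M) t (R1, M1)" "t \<le> steps B c" "P R1 M1" "f R1 M1 < f R M"
        using step[OF less.prems False] unfolding runs_def by blast
      obtain u R2 M2 where 2: "exec (While i c) (R1, M1) u (R2, M2)"
        "u \<le> Suc (f R1 M1 * Suc (steps B c))" "Q R2 M2"
        using less.hyps[OF 1(4,3)] by blast
      have "Suc (f R1 M1) * Suc (steps B c) \<le> f R M * Suc (steps B c)"
        using 1(4) by (intro mult_right_mono) auto
      then have "Suc (t + u) \<le> Suc (f R M * Suc (steps B c))" using 1(2) 2(2) by simp
      moreover have "exec (While i c) (R, M) (Suc (t + u)) (R2, M2)"
        using exec.While_True[of R i, OF False 1(1) 2(1)] .
      ultimately show ?thesis using 2(3) by blast
    qed
  qed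
  then obtain t R' M' where t: "exec (While i c) (R, M) t (R', M')"
    "t \<le> Suc (f R M * Suc (steps B c))" "Q R' M'" by blast
  have "f R M * Suc (steps B c) \<le> B * Suc (steps B c)" using assms(2) by (rule mult_right_mono) simp
  then show ?thesis using t unfolding runs_def by (metis Suc_le_mono le_trans steps.simps(3))
qed

text \<open>Throughout, register 1 holds the constant 1 and register 2 the constant 0. The loop
  \<open>For i c\<close> runs \<open>c\<close> with register \<open>i\<close> counting down from one less than its initial value.\<close>

definition For :: "nat \<Rightarrow> com \<Rightarrow> com" where
  "For i c = While i (Seq (Sub i i 1) c)"

lemma writes_For [simp]: "writes (For i c) = insert i (writes c)"
  by (simp add: For_def)

lemma storeless_For [simp]: "storeless (For i c) = storeless c"
  by (simp add: For_def)

text \<open>The invariant is indexed by the number of iterations still to come. By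
  \<open>indep\<close> it ignores the counter register and so survives the decrement that precedes
  the body.\<close>

lemma runs_For:
  assumes "R0 i \<le> B" "R0 1 = 1" "i \<noteq> 1" "i \<notin> writes c" "1 \<notin> writes c"
    and indep: "\<And>j R M v. P j (R(i := v)) M \<longleftrightarrow> P j R M"
    and init: "P (R0 i) R0 M0"
    and step: "\<And>j R M. j < R0 i \<Longrightarrow> P (Suc j) R M \<Longrightarrow> R i = j \<Longrightarrow>
      (\<And>x. x \<notin> insert i (writes c) \<Longrightarrow> R x = R0 x) \<Longrightarrow> (storeless c \<Longrightarrow> M = M0) \<Longrightarrow> runs B c R M (P j)"
    and post: "\<And>R M. P 0 R M \<Longrightarrow> R i = 0 \<Longrightarrow>
      (\<And>x. x \<notin> insert i (writes c) \<Longrightarrow> R x = R0 x) \<Longrightarrow> (storeless c \<Longrightarrow> M = M0) \<Longrightarrow> Q R M"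
  shows "runs B (For i c) R0 M0 Q"
  unfolding For_def
proof (rule runs_While[where f = "\<lambda>R M. R i" and
      P = "\<lambda>R M. P (R i) R M \<and> R i \<le> R0 i \<and> (\<forall>x. x \<notin> insert i (writes c) \<longrightarrow> R x = R0 x) \<and>
        (storeless c \<longrightarrow> M = M0)"])
  show "R0 i \<le> B" by fact
next
  fix R M
  assume inv: "P (R i) R M \<and> R i \<le> R0 i \<and> (\<forall>x. x \<notin> insert i (writes c) \<longrightarrow> R x = R0 x) \<and>
    (storeless c \<longrightarrow> M = M0)" and "R i \<noteq> 0"
  then obtain j where j: "R i = Suc j" by (cases "R i") auto
  have R1: "R 1 = 1" using inv assms(2,3,5) by auto
  have "runs B c (R(i := j)) M (P j)"
    using inv j indep by (intro step) auto
  then have "runs B c (R(i := j)) M (\<lambda>R' M'. (P (R' i) R' M' \<and> R' i \<le> R0 i \<and>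
        (\<forall>x. x \<notin> insert i (writes c) \<longrightarrow> R' x = R0 x) \<and> (storeless c \<longrightarrow> M' = M0)) \<and> R' i < R i)"
    by (rule runs_mono) (use inv j assms(4) in auto)
  then show "runs B (Seq (Sub i i 1) c) R M (\<lambda>R' M'. (P (R' i) R' M' \<and> R' i \<le> R0 i \<and>
        (\<forall>x. x \<notin> insert i (writes c) \<longrightarrow> R' x = R0 x) \<and> (storeless c \<longrightarrow> M' = M0)) \<and> R' i < R i)"
    using j R1 by (intro runs_Seq runs_Sub) simp
qed (use init post in auto)

lemmas runs_intros = runs_Seq runs_Const runs_Add runs_Sub runs_Load runs_Store runs_If

abbreviation Move :: "nat \<Rightarrow> nat \<Rightarrow> com" where
  "Move i j \<equiv> Add i j 2"

abbreviation Skip :: com where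
  "Skip \<equiv> Const 13 0"

section \<open>Orientations by push and relabel\<close>

definition outdeg :: "nat \<Rightarrow> (nat \<Rightarrow> nat \<Rightarrow> nat) \<Rightarrow> nat \<Rightarrow> nat" where
  "outdeg n D v = (\<Sum>j<n. D v j)"

definition cap :: "nat \<Rightarrow> nat \<Rightarrow> nat \<Rightarrow> nat" where
  "cap c r v = (if v = r then 0 else c)"

text \<open>Each edge is doubled; \<open>D i j\<close> of the parallel copies are directed from \<open>i\<close> to \<open>j\<close>. So the
  symmetric adjacency matrix itself is an admissible start.\<close>

definition orients :: "nat \<Rightarrow> (nat \<Rightarrow> nat \<Rightarrow> bool) \<Rightarrow> (nat \<Rightarrow> nat \<Rightarrow> nat) \<Rightarrow> bool" where
  "orients n A D \<longleftrightarrow> (\<forall>i<n. \<forall>j<n. D i j + D j i = 2 * of_bool (A i j))"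

text \<open>A valid push-relabel labelling, where excess out-degree travels along an arc by
  reversing it. A vertex is raised only when it has excess, and its out-degree never falls below its
  capacity afterwards.\<close>

definition height_inv ::
  "nat \<Rightarrow> nat \<Rightarrow> nat \<Rightarrow> (nat \<Rightarrow> nat \<Rightarrow> nat) \<Rightarrow> (nat \<Rightarrow> nat) \<Rightarrow> bool" where
  "height_inv n c r D h \<longleftrightarrow>
     (\<forall>i<n. \<forall>j<n. 0 < D i j \<longrightarrow> h i \<le> Suc (h j)) \<and>
     (\<forall>v<n. 0 < h v \<longrightarrow> cap c r v \<le> outdeg n D v) \<and> (\<forall>v<n. h v \<le> n)"

text \<open>\<open>S\<close> violates Hakimi's condition. The double sum runs over ordered pairs and
  so counts each edge twice, in agreement with the doubled arcs.\<close>

definition overfull :: "nat \<Rightarrow> (nat \<Rightarrow> nat \<Rightarrow> bool) \<Rightarrow> nat \<Rightarrow> nat \<Rightarrow> bool" where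
  "overfull n A c r \<longleftrightarrow> (\<exists>S\<subseteq>{..<n}. sum (cap c r) S < (\<Sum>i\<in>S. \<Sum>j\<in>S. of_bool (A i j)))"

text \<open>A push moves one unit of out-degree one level down and lowers the first term by one. A
  relabel raises that term by the out-degree, at most \<open>2 * n\<close>, which the weight
  \<open>2 * n + 1\<close> of the remaining height outdoes.\<close>

definition potential :: "nat \<Rightarrow> (nat \<Rightarrow> nat \<Rightarrow> nat) \<Rightarrow> (nat \<Rightarrow> nat) \<Rightarrow> nat" where
  "potential n D h = (\<Sum>v<n. outdeg n D v * h v + (2 * n + 1) * (n - h v))"

definition push :: "nat \<Rightarrow> nat \<Rightarrow> (nat \<Rightarrow> nat \<Rightarrow> nat) \<Rightarrow> nat \<Rightarrow> nat \<Rightarrow> nat" where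
  "push v y D i j = (if i = v \<and> j = y then D v y - 1 else if i = y \<and> j = v then Suc (D y v) else D i j)"

text \<open>Symmetrising the sum shows that the number of arcs inside \<open>S\<close> does not
  depend on the orientation.\<close>

lemma orients_sum:
  assumes "orients n A D" "S \<subseteq> {..<n}"
  shows "(\<Sum>i\<in>S. \<Sum>j\<in>S. D i j) = (\<Sum>i\<in>S. \<Sum>j\<in>S. of_bool (A i j))"
proof -
  have "(\<Sum>i\<in>S. \<Sum>j\<in>S. D i j) + (\<Sum>i\<in>S. \<Sum>j\<in>S. D i j) = (\<Sum>i\<in>S. \<Sum>j\<in>S. D i j + D j i)"
    using sum.swap[of D S S] by (simp add: sum.distrib)
  also have "\<dots> = (\<Sum>i\<in>S. \<Sum>j\<in>S. 2 * of_bool (A i j))"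
  proof (intro sum.cong refl)
    fix i j assume "i \<in> S" "j \<in> S"
    then have "i < n" "j < n" using assms(2) by auto
    then show "D i j + D j i = 2 * of_bool (A i j)" using assms(1) unfolding orients_def by blast
  qed
  also have "\<dots> = 2 * (\<Sum>i\<in>S. \<Sum>j\<in>S. of_bool (A i j))" by (simp add: sum_distrib_left)
  finally show ?thesis by simp
qed

lemma orients_le: "orients n A D \<Longrightarrow> i < n \<Longrightarrow> j < n \<Longrightarrow> D i j \<le> 2"
  unfolding orients_def by (metis add_leD1 mult.right_neutral mult_le_mono2 of_bool_def order_refl zero_le_one)

lemma orients_irrefl: "orients n A D \<Longrightarrow> v < n \<Longrightarrow> \<not> A v v \<Longrightarrow> D v v = 0"
  unfolding orients_def by fastforce

text \<open>Some level below \<open>n\<close> is empty, and no arc leaves the set of vertices above it.\<close>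

lemma overfull_if_high:
  assumes "orients n A D" "height_inv n c r D h" "v < n" "n \<le> h v" "cap c r v < outdeg n D v"
  shows "overfull n A c r"
proof -
  \<comment> \<open>The other \<open>n - 1\<close> vertices cannot occupy all \<open>n\<close>
    levels below \<open>n\<close>, and \<open>v\<close> is on none of these.\<close>
  have "\<not> {..<n} \<subseteq> h ` ({..<n} - {v})"
  proof
    assume "{..<n} \<subseteq> h ` ({..<n} - {v})"
    then have "card {..<n} \<le> card ({..<n} - {v})" by (intro surj_card_le) auto
    then show False using assms(3) by simp
  qed
  then obtain l where l: "l < n" "l \<notin> h ` ({..<n} - {v})" by auto
  define S where "S = {i. i < n \<and> l < h i}"
  have S: "S \<subseteq> {..<n}" "v \<in> S" using assms(3,4) l(1) by (auto simp: S_def)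
  then have finS: "finite S" using finite_subset by blast
  \<comment> \<open>An arc out of \<open>S\<close> would start above level \<open>l\<close> and end
    below it, as \<open>l\<close> is empty, and so descend by at least two levels.\<close>
  have closed: "D i j = 0" if "i \<in> S" "j \<in> {..<n} - S" for i j
  proof (rule ccontr)
    assume "D i j \<noteq> 0"
    then have "h i \<le> Suc (h j)" using assms(2) that by (auto simp: height_inv_def S_def)
    moreover have "l < h i" "h j \<le> l" "j < n" "j \<noteq> v" using that S(2) by (auto simp: S_def)
    ultimately show False using l(2) by (metis (no_types) DiffI empty_iff imageI insert_iff
          lessThan_iff le_less_Suc_eq less_le_trans)
  qed
  \<comment> \<open>Vertices of \<open>S\<close> have positive height, so their capacities are used
    up, and \<open>v\<close> exceeds its own.\<close>
  have "sum (cap c r) S < sum (outdeg n D) S"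
  proof (rule sum_strict_mono_ex1[OF finS])
    show "\<forall>i\<in>S. cap c r i \<le> outdeg n D i"
      using assms(2) by (auto simp: height_inv_def S_def)
  qed (use S(2) assms(5) in blast)
  also have "sum (outdeg n D) S = (\<Sum>i\<in>S. \<Sum>j\<in>S. D i j)"
    unfolding outdeg_def using closed S(1)
    by (intro sum.cong refl sum.mono_neutral_right) auto
  finally show ?thesis unfolding overfull_def orients_sum[OF assms(1) S(1)] using S(1) by blast
qed

text \<open>Arcs inside \<open>S\<close> count towards the out-degrees of \<open>S\<close>, which
  respect the capacities.\<close>

lemma not_overfull_if_no_excess:
  assumes "orients n A D" "\<And>v. v < n \<Longrightarrow> outdeg n D v \<le> cap c r v"
  shows "\<not> overfull n A c r"
proof
  assume "overfull n A c r"
  then obtain S where S: "S \<subseteq> {..<n}" "sum (cap c r) S < (\<Sum>i\<in>S. \<Sum>j\<in>S. of_bool (A i j))"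
    by (auto simp: overfull_def)
  have "(\<Sum>i\<in>S. \<Sum>j\<in>S. D i j) \<le> sum (outdeg n D) S"
    unfolding outdeg_def using S(1) by (intro sum_mono sum_mono2) auto
  also have "\<dots> \<le> sum (cap c r) S" using assms(2) S(1) by (intro sum_mono) auto
  finally show False using S(2) orients_sum[OF assms(1) S(1)] by simp
qed

lemma push_step:
  assumes "orients n A D" "height_inv n c r D h" "v < n" "y < n"
    "cap c r v < outdeg n D v" "0 < D v y" "h v = Suc (h y)"
  shows "orients n A (push v y D)" "height_inv n c r (push v y D) h"
    "potential n (push v y D) h < potential n D h"
proof -
  have vy: "v \<noteq> y" using assms(7) by auto
  show "orients n A (push v y D)"
  proof -
    have "push v y D i j + push v y D j i = D i j + D j i" for i j
      using vy assms(6) by (auto simp: push_def)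
    then show ?thesis using assms(1) by (simp add: orients_def)
  qed
  have ov: "Suc (outdeg n (push v y D) v) = outdeg n D v"
  proof -
    have "outdeg n (push v y D) v = (D v y - 1) + (\<Sum>j\<in>{..<n} - {y}. D v j)"
      unfolding outdeg_def using assms(4) vy by (subst sum.remove[of _ y]) (auto simp: push_def intro!: sum.cong)
    moreover have "outdeg n D v = D v y + (\<Sum>j\<in>{..<n} - {y}. D v j)"
      unfolding outdeg_def using assms(4) by (subst sum.remove[of _ y]) auto
    ultimately show ?thesis using assms(6) by simp
  qed
  have oy: "outdeg n (push v y D) y = Suc (outdeg n D y)"
  proof -
    have "outdeg n (push v y D) y = Suc (D y v) + (\<Sum>j\<in>{..<n} - {v}. D y j)"
      unfolding outdeg_def using assms(3) vy by (subst sum.remove[of _ v]) (auto simp: push_def intro!: sum.cong)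
    moreover have "outdeg n D y = D y v + (\<Sum>j\<in>{..<n} - {v}. D y j)"
      unfolding outdeg_def using assms(3) by (subst sum.remove[of _ v]) auto
    ultimately show ?thesis by simp
  qed
  have ou: "outdeg n (push v y D) u = outdeg n D u" if "u \<noteq> v" "u \<noteq> y" for u
    unfolding outdeg_def using that by (simp add: push_def)
  show "height_inv n c r (push v y D) h"
    unfolding height_inv_def
  proof (intro conjI allI impI)
    fix i j assume "i < n" "j < n" "0 < push v y D i j"
    then show "h i \<le> Suc (h j)"
      using assms(2,6,7) unfolding height_inv_def push_def by (auto split: if_splits)
  next
    fix u assume u: "u < n" "0 < h u"
    then have "cap c r u \<le> outdeg n D u" using assms(2) by (auto simp: height_inv_def)
    then show "cap c r u \<le> outdeg n (push v y D) u"
      using ov oy ou[of u] assms(5) by (cases "u = v"; cases "u = y") auto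
  next
    fix u assume "u < n"
    then show "h u \<le> n" using assms(2) by (auto simp: height_inv_def)
  qed
  let ?f = "\<lambda>D u. outdeg n D u * h u + (2 * n + 1) * (n - h u)"
  have split: "potential n D' h = ?f D' v + (?f D' y + (\<Sum>u\<in>{..<n} - {v} - {y}. ?f D' u))" for D'
    unfolding potential_def using assms(3,4) vy
    by (subst sum.remove[of _ v], simp, simp, subst sum.remove[of _ y]) auto
  have "(\<Sum>u\<in>{..<n} - {v} - {y}. ?f (push v y D) u) = (\<Sum>u\<in>{..<n} - {v} - {y}. ?f D u)"
    using ou by (intro sum.cong) auto
  then show "potential n (push v y D) h < potential n D h"
    unfolding split[of D] split[of "push v y D"] using assms(7) oy
    by (simp add: ov[symmetric])
qed

text \<open>No arc of \<open>v\<close> descends exactly one level, and by the invariant none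
  descends more, so \<open>v\<close> may rise by one. Its excess justifies the positive
  height.\<close>

lemma relabel_step:
  assumes "orients n A D" "height_inv n c r D h" "v < n" "\<not> A v v"
    "cap c r v < outdeg n D v" "h v < n" "\<And>y. y < n \<Longrightarrow> 0 < D v y \<Longrightarrow> h v \<noteq> Suc (h y)"
  shows "height_inv n c r D (h(v := Suc (h v)))"
    "potential n D (h(v := Suc (h v))) < potential n D h"
proof -
  let ?h = "h(v := Suc (h v))"
  show "height_inv n c r D ?h"
    unfolding height_inv_def
  proof (intro conjI allI impI)
    fix i j assume ij: "i < n" "j < n" "0 < D i j"
    then have "h i \<le> Suc (h j)" using assms(2) by (auto simp: height_inv_def)
    moreover have "i = v \<Longrightarrow> h v \<noteq> Suc (h j)" using assms(7)[of j] ij by auto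
    moreover have "i = v \<Longrightarrow> j \<noteq> v" using orients_irrefl[OF assms(1,3,4)] ij by auto
    ultimately show "?h i \<le> Suc (?h j)" by (cases "i = v"; cases "j = v") auto
  next
    fix u assume "u < n" "0 < ?h u"
    then show "cap c r u \<le> outdeg n D u"
      using assms(2,5) unfolding height_inv_def by (cases "u = v") auto
  next
    fix u assume "u < n"
    then show "?h u \<le> n" using assms(2,6) by (auto simp: height_inv_def)
  qed
  have "outdeg n D v \<le> (\<Sum>j<n. 2)"
    unfolding outdeg_def using orients_le[OF assms(1,3)] by (intro sum_mono) auto
  then have o: "outdeg n D v \<le> 2 * n" by simp
  let ?f = "\<lambda>h u. outdeg n D u * h u + (2 * n + 1) * (n - h u)"
  obtain d where d: "n - h v = Suc d" using assms(6) by (metis Suc_diff_Suc)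
  then have d': "n - Suc (h v) = d" by simp
  have "?f ?h v < ?f h v"
    using o unfolding fun_upd_same d d' by (simp add: algebra_simps)
  moreover have "potential n D h' = ?f h' v + (\<Sum>u\<in>{..<n} - {v}. ?f h' u)" for h'
    unfolding potential_def using assms(3) by (subst sum.remove[of _ v]) auto
  moreover have "(\<Sum>u\<in>{..<n} - {v}. ?f ?h u) = (\<Sum>u\<in>{..<n} - {v}. ?f h u)"
    by (intro sum.cong) auto
  ultimately show "potential n D ?h < potential n D h" by simp
qed

lemma height_inv_zero: "height_inv n c r D (\<lambda>_. 0)"
  by (simp add: height_inv_def)

lemma potential_zero: "potential n D (\<lambda>_. 0) = (2 * n + 1) * n * n"
  by (simp add: potential_def)

lemma potential_cong: "(\<And>v. v < n \<Longrightarrow> h v = h' v) \<Longrightarrow>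
    (\<And>i j. i < n \<Longrightarrow> j < n \<Longrightarrow> D i j = D' i j) \<Longrightarrow> potential n D h = potential n D' h'"
  by (auto simp: potential_def outdeg_def intro!: sum.cong)

lemma outdeg_cong: "(\<And>j. j < n \<Longrightarrow> D v j = D' v j) \<Longrightarrow> outdeg n D v = outdeg n D' v"
  by (auto simp: outdeg_def)

lemma height_inv_cong: "(\<And>v. v < n \<Longrightarrow> h v = h' v) \<Longrightarrow>
    (\<And>i j. i < n \<Longrightarrow> j < n \<Longrightarrow> D i j = D' i j) \<Longrightarrow> height_inv n c r D h \<longleftrightarrow> height_inv n c r D' h'"
  using outdeg_cong[of n D _ D'] by (auto simp: height_inv_def)

lemma orients_cong: "(\<And>i j. i < n \<Longrightarrow> j < n \<Longrightarrow> D i j = D' i j) \<Longrightarrow> orients n A D \<longleftrightarrow> orients n A D'"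
  by (auto simp: orients_def)

section \<open>The program\<close>

text \<open>Register use: 3 number \<open>n\<close> of vertices; 4 address of the matrix;
  5 address of the heights, which is the length of the input; 6 capacity; 7 root; 8 has an overfull
  set been found; 9 matrix invalid; 10, 11 loop indices; 12 result of \<open>mult\<close> and \<open>addr\<close>;
  13 to 18 scratch, where 13 may be changed by \<open>Skip\<close>; 19 selected
  vertex; 20 has a vertex been selected; 21 has an arc been found; 22 its head; 23 the number \<open>k\<close>.\<close>

definition env :: "nat \<Rightarrow> nat \<Rightarrow> nat \<Rightarrow> (nat \<Rightarrow> nat) \<Rightarrow> bool" where
  "env B n L R \<longleftrightarrow> R 1 = 1 \<and> R 2 = 0 \<and> R 3 = n \<and> R 4 = Suc n \<and> R 5 = L \<and> n \<le> B"

text \<open>The offset \<open>Suc n\<close> skips the unary vertex number and its end marker: the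
  matrix is worked on in place, inside the input.\<close>

definition loc :: "nat \<Rightarrow> nat \<Rightarrow> nat \<Rightarrow> nat" where
  "loc n i j = Suc n + i * n + j"

definition cell :: "nat \<Rightarrow> (nat \<Rightarrow> nat) \<Rightarrow> nat \<Rightarrow> nat \<Rightarrow> nat" where
  "cell n M i j = M (loc n i j)"

definition hgt :: "nat \<Rightarrow> (nat \<Rightarrow> nat) \<Rightarrow> nat \<Rightarrow> nat" where
  "hgt L M v = M (L + v)"

definition mult :: "nat \<Rightarrow> nat \<Rightarrow> com" where
  "mult a b = Seq (Const 12 0) (Seq (Move 13 a) (For 13 (Add 12 12 b)))"

definition addr :: "nat \<Rightarrow> nat \<Rightarrow> com" where
  "addr a b = Seq (mult a 3) (Seq (Add 12 12 4) (Add 12 12 b))"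

definition get :: "nat \<Rightarrow> nat \<Rightarrow> nat \<Rightarrow> com" where
  "get d a b = Seq (addr a b) (Load d 12)"

lemma writes_mult [simp]: "writes (mult a b) = {12, 13}"
  and storeless_mult [simp]: "storeless (mult a b)"
  by (auto simp: mult_def)

lemma writes_get [simp]: "writes (get d a b) = {12, 13, d}"
  and storeless_get [simp]: "storeless (get d a b)"
  by (auto simp: get_def addr_def)

text \<open>Multiplication is repeated addition, hence the bound on the first factor. The program
  multiplies only \<open>n\<close> and vertex indices, never \<open>k\<close>.\<close>

lemma runs_mult:
  assumes "R 1 = 1" "R 2 = 0" "R a \<le> B" "a \<notin> {12, 13}" "b \<notin> {12, 13}"
    and Q: "Q (R(12 := R a * R b, 13 := 0)) M"
  shows "runs B (mult a b) R M Q"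
  unfolding mult_def
proof (intro runs_Seq runs_Const runs_Add)
  let ?R0 = "R(12 := 0, 13 := (R(12 := 0)) a + (R(12 := 0)) 2)"
  have R0: "?R0 13 = R a" using assms by simp
  show "runs B (For 13 (Add 12 12 b)) ?R0 M Q"
  proof (rule runs_For[where P = "\<lambda>j R' M'. R' 12 = (R a - j) * R b"])
    fix j R' M'
    assume j: "j < ?R0 13" and inv: "R' 12 = (R a - Suc j) * R b"
      and frame: "\<And>x. x \<notin> insert 13 (writes (Add 12 12 b)) \<Longrightarrow> R' x = ?R0 x"
    have "R' b = R b" using frame[of b] assms(5) by simp
    moreover have "R a - j = Suc (R a - Suc j)" using j R0 by simp
    ultimately show "runs B (Add 12 12 b) R' M' (\<lambda>R' M'. R' 12 = (R a - j) * R b)"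
      using inv by (intro runs_Add) simp
  next
    fix R' M'
    assume *: "R' 12 = (R a - 0) * R b" "R' 13 = 0"
      "\<And>x. x \<notin> insert 13 (writes (Add 12 12 b)) \<Longrightarrow> R' x = ?R0 x"
      "storeless (Add 12 12 b) \<Longrightarrow> M' = M"
    have "R' = R(12 := R a * R b, 13 := 0)"
      using * by (auto simp: fun_eq_iff)
    then show "Q R' M'" using Q *(4) by simp
  qed (use assms R0 in auto)
qed

lemma runs_addr:
  assumes "env B n L R" "R a \<le> B" "a \<notin> {12, 13}" "b \<notin> {12, 13}"
    and Q: "Q (R(12 := loc n (R a) (R b), 13 := 0)) M"
  shows "runs B (addr a b) R M Q"
proof -
  have "R(12 := loc n (R a) (R b), 13 := 0) = R(13 := 0, 12 := loc n (R a) (R b))"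
    by (simp add: fun_upd_twist)
  then show ?thesis
    using assms unfolding addr_def env_def
    by (intro runs_Seq runs_mult runs_Add) (simp_all add: loc_def fun_upd_twist add_ac)
qed

lemma runs_get:
  assumes "env B n L R" "R a \<le> B" "a \<notin> {12, 13}" "b \<notin> {12, 13}"
    and Q: "Q (R(12 := loc n (R a) (R b), 13 := 0, d := cell n M (R a) (R b))) M"
  shows "runs B (get d a b) R M Q"
  unfolding get_def using assms
  by (intro runs_Seq runs_addr[OF assms(1-4)] runs_Load) (simp add: cell_def)

lemma env_upd [simp]: "i \<notin> {1, 2, 3, 4, 5} \<Longrightarrow> env B n L (R(i := x)) = env B n L R"
  by (auto simp: env_def)

lemma env_frame: "env B n L R0 \<Longrightarrow> (\<And>x. x \<in> {1, 2, 3, 4, 5} \<Longrightarrow> R x = R0 x) \<Longrightarrow> env B n L R"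
  by (simp add: env_def)

text \<open>The loop over all vertices, in descending order. The frame conditions restore
  \<open>env\<close> and the registers of a surrounding loop in each round.\<close>

lemma runs_For_env:
  assumes "env B n L R0" "i \<noteq> 1" "i \<noteq> 2" "i \<noteq> 3" "i \<noteq> 4" "i \<noteq> 5" "i \<notin> writes c" "writes c \<inter> {1, 2, 3, 4, 5} = {}"
    and indep: "\<And>j R M v. P j (R(i := v)) M \<longleftrightarrow> P j R M"
    and init: "P n R0 M0"
    and step: "\<And>j R M. j < n \<Longrightarrow> P (Suc j) R M \<Longrightarrow> R i = j \<Longrightarrow> env B n L R \<Longrightarrow>
      (\<And>x. x \<notin> insert i (writes c) \<Longrightarrow> R x = R0 x) \<Longrightarrow> (storeless c \<Longrightarrow> M = M0) \<Longrightarrow> runs B c R M (P j)"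
    and post: "\<And>R M. P 0 R M \<Longrightarrow> env B n L R \<Longrightarrow>
      (\<And>x. x \<notin> insert i (writes c) \<Longrightarrow> R x = R0 x) \<Longrightarrow> (storeless c \<Longrightarrow> M = M0) \<Longrightarrow> Q R M"
  shows "runs B (Seq (Move i 3) (For i c)) R0 M0 Q"
proof (intro runs_Seq runs_Add)
  let ?R0 = "R0(i := R0 3 + R0 2)"
  have Ri: "?R0 i = n" using assms(1) by (simp add: env_def)
  have fr: "R x = R0 x" if "\<And>x. x \<notin> insert i (writes c) \<Longrightarrow> R x = ?R0 x" "x \<notin> insert i (writes c)" for R x
    using that(1)[OF that(2)] that(2) by simp
  have en: "env B n L R" if H: "\<And>x. x \<notin> insert i (writes c) \<Longrightarrow> R x = ?R0 x" for R
  proof (rule env_frame[OF assms(1)])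
    show "R x = R0 x" if "x \<in> {1, 2, 3, 4, 5}" for x
      using that assms(2-6,8) by (intro fr[OF H]) auto
  qed
  show "runs B (For i c) ?R0 M0 Q"
  proof (rule runs_For[where P = P])
    show "?R0 i \<le> B" "?R0 1 = 1" using assms(1,2) by (simp_all add: env_def)
    show "i \<noteq> 1" "i \<notin> writes c" "1 \<notin> writes c" using assms by auto
    show "P j (R(i := v)) M \<longleftrightarrow> P j R M" for j R M v by (rule indep)
    show "P (?R0 i) ?R0 M0" unfolding Ri indep by (rule init)
  next
    fix j R M
    assume "j < ?R0 i" "P (Suc j) R M" "R i = j" "\<And>x. x \<notin> insert i (writes c) \<Longrightarrow> R x = ?R0 x"
      "storeless c \<Longrightarrow> M = M0"
    note H = this
    show "runs B c R M (P j)"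
      by (rule step[OF _ H(2,3) en[OF H(4)] fr[OF H(4)] H(5)]) (use H(1) Ri in simp_all)
  next
    fix R M
    assume "P 0 R M" "\<And>x. x \<notin> insert i (writes c) \<Longrightarrow> R x = ?R0 x" "storeless c \<Longrightarrow> M = M0"
    note H = this
    show "Q R M" by (rule post[OF H(1) en[OF H(2)] fr[OF H(2)] H(3)])
  qed
qed

section \<open>Selecting a vertex with excess\<close>

definition rowsum :: com where
  "rowsum = Seq (Const 16 0) (Seq (Move 11 3) (For 11 (Seq (get 14 10 11) (Add 16 16 14))))"

lemma writes_rowsum [simp]: "writes rowsum = {11, 12, 13, 14, 16}"
  and storeless_rowsum [simp]: "storeless rowsum"
  by (auto simp: rowsum_def)

lemma runs_rowsum:
  assumes "env B n L R" "R 10 < n"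
  shows "runs B rowsum R M (\<lambda>R' M'. R' 16 = outdeg n (cell n M) (R 10))"
  unfolding rowsum_def
proof (rule runs_Seq, rule runs_Const, rule runs_For_env[where L = L and n = n and
      P = "\<lambda>j R' M'. R' 16 = (\<Sum>y = j..<n. cell n M (R 10) y)"])
  let ?c = "Seq (get 14 10 11) (Add 16 16 14)"
  fix j R' M'
  assume j: "j < n" "R' 16 = (\<Sum>y = Suc j..<n. cell n M (R 10) y)" "R' 11 = j" "env B n L R'"
    and frame: "\<And>x. x \<notin> insert 11 (writes ?c) \<Longrightarrow> R' x = (R(16 := 0)) x"
    and M: "storeless ?c \<Longrightarrow> M' = M"
  have "R' 10 = R 10" using frame[of 10] by simp
  then show "runs B ?c R' M' (\<lambda>R' M'. R' 16 = (\<Sum>y = j..<n. cell n M (R 10) y))"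
    using j assms M by (intro runs_Seq runs_get[OF j(4)] runs_Add)
      (auto simp: env_def sum.atLeast_Suc_lessThan[of j n])
qed (use assms in \<open>auto simp: outdeg_def atLeast0LessThan\<close>)

text \<open>At least one of the two truncated differences vanishes, so their sum is the distance to
  the root and is zero exactly there.\<close>

definition capacity :: com where
  "capacity = Seq (Sub 17 10 7) (Seq (Sub 18 7 10) (Seq (Add 17 17 18) (If 17 (Move 17 6) (Const 17 0))))"

lemma writes_capacity [simp]: "writes capacity = {17, 18}"
  and storeless_capacity [simp]: "storeless capacity"
  by (auto simp: capacity_def)

lemma runs_capacity:
  assumes "R 2 = 0"
  shows "runs B capacity R M (\<lambda>R' M'. R' 17 = cap (R 6) (R 7) (R 10))"
  unfolding capacity_def using assms by (intro runs_intros) (auto simp: cap_def)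

text \<open>A vertex with excess below height \<open>n\<close> becomes the candidate. One at height
  \<open>n\<close> is left alone and raises the flag in register 8, as it certifies an overfull set
  by \<open>overfull_if_high\<close>.\<close>

definition select :: com where
  "select = Seq (Const 20 0) (Seq (Move 10 3) (For 10 (Seq rowsum (Seq capacity (Seq (Sub 17 16 17)
     (If 17 (Seq (Add 18 5 10) (Seq (Load 18 18) (Seq (Sub 18 3 18)
        (If 18 (Seq (Move 19 10) (Const 20 1)) (Const 8 1))))) Skip))))))"

lemma writes_select [simp]: "writes select = {8, 10, 11, 12, 13, 14, 16, 17, 18, 19, 20}"
  and storeless_select [simp]: "storeless select"
  by (auto simp: select_def)

definition excess :: "nat \<Rightarrow> nat \<Rightarrow> nat \<Rightarrow> (nat \<Rightarrow> nat) \<Rightarrow> nat \<Rightarrow> bool" where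
  "excess n c r M v \<longleftrightarrow> cap c r v < outdeg n (cell n M) v"

text \<open>Invariant of \<open>select\<close> once the vertices from \<open>j\<close> on are
  inspected; \<open>found0\<close> is the flag left by earlier scans and roots.\<close>

definition scanned :: "nat \<Rightarrow> nat \<Rightarrow> nat \<Rightarrow> nat \<Rightarrow> (nat \<Rightarrow> nat) \<Rightarrow> bool \<Rightarrow> nat \<Rightarrow> nat \<Rightarrow> nat \<Rightarrow> nat \<Rightarrow> bool" where
  "scanned n L c r M found0 j sel v found \<longleftrightarrow>
    (sel \<noteq> 0 \<longrightarrow> v < n \<and> excess n c r M v \<and> hgt L M v < n) \<and>
    (sel = 0 \<longrightarrow> (\<forall>u<n. j \<le> u \<longrightarrow> excess n c r M u \<longrightarrow> n \<le> hgt L M u)) \<and>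
    (found \<noteq> 0 \<longleftrightarrow> found0 \<or> (\<exists>u<n. j \<le> u \<and> excess n c r M u \<and> n \<le> hgt L M u))"

lemma all_ge_Suc: "(\<forall>u<n. j \<le> u \<longrightarrow> P u) \<longleftrightarrow> (j < n \<longrightarrow> P j) \<and> (\<forall>u<n. Suc j \<le> u \<longrightarrow> P u)"
  by (metis Suc_leD le_eq_less_or_eq less_eq_Suc_le)

lemma ex_ge_Suc: "(\<exists>u<n. j \<le> u \<and> P u) \<longleftrightarrow> j < n \<and> P j \<or> (\<exists>u<n. Suc j \<le> u \<and> P u)"
  by (metis Suc_leD le_eq_less_or_eq less_eq_Suc_le)

lemma scanned_step:
  assumes "scanned n L c r M a (Suc j) sel v found" "j < n"
  shows "\<not> excess n c r M j \<Longrightarrow> scanned n L c r M a j sel v found"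
    and "excess n c r M j \<Longrightarrow> hgt L M j < n \<Longrightarrow> scanned n L c r M a j 1 j found"
    and "excess n c r M j \<Longrightarrow> n \<le> hgt L M j \<Longrightarrow> scanned n L c r M a j sel v 1"
  using assms unfolding scanned_def all_ge_Suc[of n j] ex_ge_Suc[of n j] by simp_all

lemma runs_select:
  assumes "env B n L R"
  shows "runs B select R M (\<lambda>R' M'. scanned n L (R 6) (R 7) M (R 8 \<noteq> 0) 0 (R' 20) (R' 19) (R' 8))"
  unfolding select_def
proof (rule runs_Seq, rule runs_Const, rule runs_For_env[where L = L and n = n and
    P = "\<lambda>j R' M'. scanned n L (R 6) (R 7) M (R 8 \<noteq> 0) j (R' 20) (R' 19) (R' 8)"],
    goal_cases)
  case (11 j R' M')
  have R': "R' 6 = R 6" "R' 7 = R 7" "R' 10 = j" using 11(5)[of 6] 11(5)[of 7] 11(3) by simp_all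
  have M': "M' = M" using 11(6) by simp
  show ?case
    apply (rule runs_Seq, rule runs_mono[OF runs_rowsum[OF 11(4)]])
    subgoal using R' 11(1) by simp
    subgoal premises p1 for R1 M1
      apply (rule runs_Seq, rule runs_mono[OF runs_capacity])
      subgoal using p1(2)[of 2] 11(4) by (simp add: env_def)
      subgoal premises p2 for R2 M2
      proof -
        have fr: "R2 x = R' x" if "x \<notin> {11, 12, 13, 14, 16, 17, 18}" for x
          using p1(2)[of x] p2(2)[of x] that by simp
        have env2: "env B n L R2" by (rule env_frame[OF 11(4)]) (auto simp: fr)
        have R2: "R2 16 = outdeg n (cell n M) j" "R2 17 = cap (R 6) (R 7) j" "R2 10 = j" "R2 5 = L" "R2 3 = n"
            "R2 20 = R' 20" "R2 19 = R' 19" "R2 8 = R' 8" "R2 2 = 0"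
          using p1 p2 R' env2 fr M' by (simp_all add: env_def)
        have M2: "M2 = M" using p1 p2 M' by simp
        note st = scanned_step[OF 11(2,1)]
        show ?thesis
          apply (intro runs_intros)
          subgoal using st(2) by (simp add: R2 M2 excess_def hgt_def)
          subgoal using st(3) by (simp add: R2 M2 excess_def hgt_def)
          subgoal using st(1) by (simp add: R2 M2 excess_def hgt_def)
          done
      qed
      done
    done
qed (use assms in \<open>auto simp: scanned_def\<close>)

section \<open>One push or one relabel\<close>

definition height_gap :: com where
  "height_gap = Seq (Add 16 5 11) (Seq (Load 16 16) (Seq (Add 16 16 1) (Seq (Sub 17 15 16)
    (Seq (Sub 18 16 15) (Add 17 17 18)))))"

lemma writes_height_gap [simp]: "writes height_gap = {16, 17, 18}"
  and storeless_height_gap [simp]: "storeless height_gap"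
  by (auto simp: height_gap_def)

lemma runs_height_gap:
  assumes "R 1 = 1"
  shows "runs B height_gap R M (\<lambda>R' M'. R' 17 = 0 \<longleftrightarrow> R 15 = Suc (M (R 5 + R 11)))"
  unfolding height_gap_def
proof (intro runs_intros, goal_cases)
  case 1
  have "(a::nat) - Suc b + (Suc b - a) = 0 \<longleftrightarrow> a = Suc b" for a b by arith
  then show ?case using assms by simp
qed

text \<open>The scan keeps the last admissible arc that it meets. \<open>get\<close> leaves the
  address of the entry in register 12, where the following \<open>Store\<close> finds it.\<close>

definition act :: com where
  "act = Seq (Const 21 0) (Seq (Add 15 5 19) (Seq (Load 15 15) (Seq
    (Seq (Move 11 3) (For 11 (Seq (get 14 19 11) (If 14
      (Seq height_gap (If 17 Skip (Seq (Const 21 1) (Move 22 11))))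
      Skip))))
    (If 21
      (Seq (get 14 19 22) (Seq (Sub 14 14 1) (Seq (Store 12 14)
        (Seq (get 14 22 19) (Seq (Add 14 14 1) (Store 12 14))))))
      (Seq (Add 16 5 19) (Seq (Add 15 15 1) (Store 16 15)))))))"

lemma writes_act [simp]: "writes act = {11, 12, 13, 14, 15, 16, 17, 18, 21, 22}"
  by (auto simp: act_def)

definition admissible :: "nat \<Rightarrow> nat \<Rightarrow> (nat \<Rightarrow> nat) \<Rightarrow> nat \<Rightarrow> nat \<Rightarrow> bool" where
  "admissible n L M v y \<longleftrightarrow> 0 < cell n M v y \<and> hgt L M v = Suc (hgt L M y)"

text \<open>The two stores in program order: the second entry is read from the memory already
  changed by the first. For \<open>v \<noteq> y\<close> the resulting matrix is that of
  \<open>push\<close>.\<close>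

definition pushed :: "nat \<Rightarrow> (nat \<Rightarrow> nat) \<Rightarrow> nat \<Rightarrow> nat \<Rightarrow> nat \<Rightarrow> nat" where
  "pushed n M v y = (let M1 = M(loc n v y := cell n M v y - 1) in M1(loc n y v := Suc (cell n M1 y v)))"

lemma runs_act:
  assumes "env B n L R" "R 19 = v" "v < n"
  shows "runs B act R M (\<lambda>R' M'.
    (\<exists>y<n. admissible n L M v y \<and> M' = pushed n M v y) \<or>
    (\<forall>y<n. \<not> admissible n L M v y) \<and> M' = M(L + v := Suc (hgt L M v)))"
  unfolding act_def
proof (rule runs_Seq, rule runs_Const, rule runs_Seq, rule runs_Add, rule runs_Seq, rule runs_Load, rule runs_Seq, rule runs_For_env[where L = L and n = n and
    P = "\<lambda>j R' M'. (R' 21 \<noteq> 0 \<longrightarrow> R' 22 < n \<and> admissible n L M v (R' 22)) \<and>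
      (R' 21 = 0 \<longrightarrow> (\<forall>y<n. j \<le> y \<longrightarrow> \<not> admissible n L M v y))"], goal_cases)
  case (11 j R' M')
  have R': "R' 19 = v" "R' 15 = hgt L M v" "R' 11 = j" "R' (Suc 0) = 1" "R' 2 = 0" "R' 5 = L"
    using 11(5)[of 19] 11(5)[of 15] 11(3,4) assms by (simp_all add: hgt_def env_def)
  have M': "M' = M" using 11(6) by simp
  have B: "n \<le> B" using assms(1) by (simp add: env_def)
  let ?P = "\<lambda>j R' M'. (R' 21 \<noteq> 0 \<longrightarrow> R' 22 < n \<and> admissible n L M v (R' 22)) \<and>
      (R' 21 = 0 \<longrightarrow> (\<forall>y<n. j \<le> y \<longrightarrow> \<not> admissible n L M v y))"
  have st: "?P j R' M'" if "\<not> admissible n L M v j"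
    using 11(1,2) that all_ge_Suc[of n j "\<lambda>y. \<not> admissible n L M v y"] by argo
  show ?case
  proof (rule runs_Seq, rule runs_mono[OF runs_get[OF 11(4), where Q = "\<lambda>R M. R 14 = cell n M' v j"]],
      goal_cases)
    case (5 R2 M2)
    then have M2: "M2 = M" and c: "R2 14 = cell n M v j" using M' by simp_all
    have R2: "R2 21 = R' 21" "R2 22 = R' 22" "R2 15 = hgt L M v" "R2 11 = j" "R2 1 = 1" "R2 2 = 0" "R2 5 = L"
      using 5(2)[of 21] 5(2)[of 22] 5(2)[of 15] 5(2)[of 11] 5(2)[of 1] 5(2)[of 2] 5(2)[of 5] R' by simp_all
    show ?case
    proof (rule runs_If)
      assume "R2 14 = 0"
      then have "\<not> admissible n L M v j" using c by (simp add: admissible_def)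
      from st[OF this] show "runs B Skip R2 M2 (?P j)"
        by (intro runs_Const) (simp add: R2)
    next
      assume 14: "R2 14 \<noteq> 0"
      show "runs B (Seq height_gap (If 17 Skip (Seq (Const 21 1) (Move 22 11)))) R2 M2 (?P j)"
      proof (rule runs_Seq, rule runs_mono[OF runs_height_gap[of R2, OF R2(5)]], rule runs_If)
        fix R3 M3
        assume 17: "R3 17 = 0 \<longleftrightarrow> R2 15 = Suc (M2 (R2 5 + R2 11))"
          and fr: "\<And>x. x \<notin> writes height_gap \<Longrightarrow> R3 x = R2 x"
        have R3: "R3 21 = R' 21" "R3 22 = R' 22" "R3 11 = j" "R3 2 = 0"
          using fr[of 21] fr[of 22] fr[of 11] fr[of 2] R2 by simp_all
        have adm: "admissible n L M v j \<longleftrightarrow> R3 17 = 0"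
          using 17 14 c by (simp add: admissible_def hgt_def R2 M2)
        show "runs B Skip R3 M3 (?P j)" if "R3 17 \<noteq> 0"
          using st adm that by (intro runs_Const) (simp add: R3)
        show "runs B (Seq (Const 21 1) (Move 22 11)) R3 M3 (?P j)" if "R3 17 = 0"
          using adm that 11(1) by (intro runs_intros) (simp add: R3)
      qed
    qed
  qed (use R' B assms(3) in simp_all)
next
  case (12 R' M')
  have R': "R' 19 = v" "R' 15 = hgt L M v" "R' (Suc 0) = 1" "R' 2 = 0" "R' 5 = L"
    using 12(3)[of 19] 12(3)[of 15] 12(2) assms by (simp_all add: hgt_def env_def)
  have M': "M' = M" using 12(4) by simp
  have B: "n \<le> B" using assms(1) by (simp add: env_def)
  show ?case
  proof (rule runs_If)
    assume 21: "R' 21 \<noteq> 0"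
    then have y: "R' 22 < n" "admissible n L M v (R' 22)" using 12(1) by auto
    show "runs B (Seq (get 14 19 22) (Seq (Sub 14 14 1) (Seq (Store 12 14)
        (Seq (get 14 22 19) (Seq (Add 14 14 1) (Store 12 14)))))) R' M' (\<lambda>R' M'.
      (\<exists>y<n. admissible n L M v y \<and> M' = pushed n M v y) \<or>
      (\<forall>y<n. \<not> admissible n L M v y) \<and> M' = M(L + v := Suc (hgt L M v)))"
      apply (rule runs_Seq, rule runs_get[OF 12(2)])
         apply (use R' B assms(3) in simp_all)[3]
      apply (rule runs_Seq, rule runs_Sub, rule runs_Seq, rule runs_Store)
      apply (rule runs_Seq, rule runs_get[where n = n and L = L])
          apply (use 12(2) R' B assms(3) y in simp_all)[4]
      apply (rule runs_Seq, rule runs_Add, rule runs_Store)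
      apply (rule disjI1, rule exI[of _ "R' 22"])
      using y by (simp add: R' M' pushed_def Let_def)
  next
    assume 21: "R' 21 = 0"
    then show "runs B (Seq (Add 16 5 19) (Seq (Add 15 15 1) (Store 16 15))) R' M' (\<lambda>R' M'.
      (\<exists>y<n. admissible n L M v y \<and> M' = pushed n M v y) \<or>
      (\<forall>y<n. \<not> admissible n L M v y) \<and> M' = M(L + v := Suc (hgt L M v)))"
      using 12(1) by (intro runs_intros disjI2) (simp add: R' M')
  qed
qed (use assms in auto)

section \<open>Matrix entries and heights occupy disjoint memory\<close>

lemma loc_inj:
  assumes "j < n" "j' < n"
  shows "loc n i j = loc n i' j' \<longleftrightarrow> i = i' \<and> j = j'"
proof
  assume "loc n i j = loc n i' j'"
  then have e: "i * n + j = i' * n + j'" by (simp add: loc_def)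
  then have "(i * n + j) div n = (i' * n + j') div n" "(i * n + j) mod n = (i' * n + j') mod n" by simp_all
  then show "i = i' \<and> j = j'" using assms by simp
qed simp

lemma loc_less:
  assumes "i < n" "j < n" "Suc n + n * n \<le> L"
  shows "loc n i j < L"
proof -
  have "i * n + j < Suc i * n" using assms(2) by simp
  also have "\<dots> \<le> n * n" using assms(1) by (intro mult_right_mono) auto
  finally show ?thesis using assms(3) by (simp add: loc_def)
qed

lemma cell_pushed:
  assumes "i < n" "j < n" "v < n" "y < n" "v \<noteq> y"
  shows "cell n (pushed n M v y) i j = push v y (cell n M) i j"
  using assms by (auto simp: pushed_def push_def cell_def Let_def loc_inj)

lemma hgt_pushed:
  assumes "v < n" "y < n" "Suc n + n * n \<le> L"
  shows "hgt L (pushed n M v y) u = hgt L M u"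
  using loc_less[OF assms] loc_less[OF assms(2,1,3)] by (simp add: pushed_def Let_def hgt_def)

lemma hgt_upd: "hgt L (M(L + v := x)) = (hgt L M)(v := x)"
  by (auto simp: hgt_def)

lemma cell_upd:
  assumes "i < n" "j < n" "Suc n + n * n \<le> L"
  shows "cell n (M(L + v := x)) i j = cell n M i j"
  using loc_less[OF assms] by (simp add: cell_def)

section \<open>Push-relabel for one root and for all roots\<close>

text \<open>Heights start afresh for each root, but the orientation left by the previous root is
  kept: any orientation is an admissible start.\<close>

definition root :: com where
  "root = Seq (Seq (Move 10 3) (For 10 (Seq (Add 14 5 10) (Store 14 2))))
    (Seq (Const 20 1) (While 20 (Seq select (If 20 act Skip))))"

lemma writes_root [simp]: "writes root = {8, 10, 11, 12, 13, 14, 15, 16, 17, 18, 19, 20, 21, 22}"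
  by (auto simp: root_def)

lemma runs_root:
  assumes "env B n L R" "Suc n + n * n \<le> L" "(2 * n + 1) * n * n < B"
    and ori: "orients n A (cell n M)" and irr: "\<And>v. v < n \<Longrightarrow> \<not> A v v"
  shows "runs B root R M (\<lambda>R' M'. orients n A (cell n M') \<and>
    (R' 8 \<noteq> 0 \<longleftrightarrow> R 8 \<noteq> 0 \<or> overfull n A (R 6) (R 7)))"
  unfolding root_def
proof (rule runs_Seq, rule runs_For_env[where L = L and n = n and
      P = "\<lambda>j R' M'. (\<forall>v<n. j \<le> v \<longrightarrow> hgt L M' v = 0) \<and> (\<forall>i<n. \<forall>k<n. cell n M' i k = cell n M i k)"],
    goal_cases)
  case (11 j R' M')
  show ?case
    using 11(1,2,3,4) unfolding all_ge_Suc[of n j]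
    by (intro runs_intros) (auto simp: env_def hgt_upd cell_upd[OF _ _ assms(2)])
next
  case (12 R1 M1)
  let ?c = "R 6" and ?r = "R 7"
  \<comment> \<open>The flag is sound throughout, and when a scan selects nothing with the flag
    down, no vertex has excess.\<close>
  let ?P = "\<lambda>R' M'. env B n L R' \<and> R' 6 = ?c \<and> R' 7 = ?r \<and> orients n A (cell n M') \<and>
      height_inv n ?c ?r (cell n M') (hgt L M') \<and>
      (R' 8 \<noteq> 0 \<longrightarrow> R 8 \<noteq> 0 \<or> overfull n A ?c ?r) \<and> (R 8 \<noteq> 0 \<longrightarrow> R' 8 \<noteq> 0) \<and>
      (R' 20 = 0 \<longrightarrow> R' 8 = 0 \<longrightarrow> (\<forall>v<n. \<not> excess n ?c ?r M' v))"
  \<comment> \<open>The last scan selects nothing and leaves the potential alone; the drop from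
    \<open>Suc\<close> to 0 accounts for that round.\<close>
  let ?f = "\<lambda>R' M'. if R' 20 = 0 then 0 else Suc (potential n (cell n M') (hgt L M'))"
  have R1: "R1 6 = ?c" "R1 7 = ?r" "R1 8 = R 8" using 12(3)[of 6] 12(3)[of 7] 12(3)[of 8] by simp_all
  have h1: "\<And>v. v < n \<Longrightarrow> hgt L M1 v = 0" "\<And>i k. i < n \<Longrightarrow> k < n \<Longrightarrow> cell n M1 i k = cell n M i k"
    using 12(1) by auto
  show ?case
  proof (rule runs_Seq, rule runs_Const, rule runs_While[where P = ?P and f = ?f], goal_cases)
    case 1
    have "height_inv n ?c ?r (cell n M1) (hgt L M1)"
      using height_inv_cong[of n "hgt L M1" "\<lambda>_. 0" "cell n M1" "cell n M1"] height_inv_zero h1 by blast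
    moreover have "orients n A (cell n M1)" using orients_cong[of n "cell n M1" "cell n M"] ori h1 by blast
    ultimately show ?case using 12(2) R1 by simp
  next
    case 2
    have "potential n (cell n M1) (hgt L M1) = (2 * n + 1) * n * n"
      using potential_cong[of n "hgt L M1" "\<lambda>_. 0" "cell n M1" "cell n M1"] h1 potential_zero by simp
    then show ?case using assms(3) by simp
  next
    case (3 R2 M2)
    then have env2: "env B n L R2" and R2: "R2 6 = ?c" "R2 7 = ?r"
      and o2: "orients n A (cell n M2)" and hi2: "height_inv n ?c ?r (cell n M2) (hgt L M2)"
      and f2: "R2 8 \<noteq> 0 \<Longrightarrow> R 8 \<noteq> 0 \<or> overfull n A ?c ?r" "R 8 \<noteq> 0 \<Longrightarrow> R2 8 \<noteq> 0" by auto
    show ?case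
    proof (rule runs_Seq, rule runs_mono[OF runs_select[OF env2]])
      fix R3 M3
      assume sc0: "scanned n L (R2 6) (R2 7) M2 (R2 8 \<noteq> 0) 0 (R3 20) (R3 19) (R3 8)"
        and fr: "\<And>x. x \<notin> writes select \<Longrightarrow> R3 x = R2 x" and "storeless select \<Longrightarrow> M3 = M2"
      then have M3: "M3 = M2" by simp
      note sc = sc0[unfolded R2 scanned_def]
      have env3: "env B n L R3" by (rule env_frame[OF env2]) (auto intro!: fr)
      have R3: "R3 6 = ?c" "R3 7 = ?r" using fr[of 6] fr[of 7] R2 by simp_all
      \<comment> \<open>A newly raised flag comes from a vertex with excess at height
        \<open>n\<close>, where \<open>overfull_if_high\<close> applies.\<close>
      have of3: "R3 8 \<noteq> 0 \<Longrightarrow> R 8 \<noteq> 0 \<or> overfull n A ?c ?r"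
        using sc f2(1) overfull_if_high[OF o2 hi2] unfolding excess_def by blast
      have f3: "R 8 \<noteq> 0 \<Longrightarrow> R3 8 \<noteq> 0" using sc f2(2) by blast
      show "runs B (If 20 act Skip) R3 M3 (\<lambda>R' M'. ?P R' M' \<and> ?f R' M' < ?f R2 M2)"
      proof (rule runs_If)
        assume 20: "R3 20 = 0"
        then have "R3 8 = 0 \<longrightarrow> (\<forall>v<n. \<not> excess n ?c ?r M2 v)" using sc by blast
        then show "runs B Skip R3 M3 (\<lambda>R' M'. ?P R' M' \<and> ?f R' M' < ?f R2 M2)"
          using env3 R3 o2 hi2 of3 f3 20 3(2) M3 by (intro runs_Const) simp
      next
        assume 20: "R3 20 \<noteq> 0"
        define v where "v = R3 19"
        have v: "v < n" "excess n ?c ?r M2 v" "hgt L M2 v < n" using sc 20 by (auto simp: v_def)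
        show "runs B act R3 M3 (\<lambda>R' M'. ?P R' M' \<and> ?f R' M' < ?f R2 M2)"
        proof (rule runs_mono[OF runs_act[OF env3 v_def[symmetric] v(1)]])
          fix R4 M4
          assume act: "(\<exists>y<n. admissible n L M3 v y \<and> M4 = pushed n M3 v y) \<or>
              (\<forall>y<n. \<not> admissible n L M3 v y) \<and> M4 = M3(L + v := Suc (hgt L M3 v))"
            and fr4: "\<And>x. x \<notin> writes act \<Longrightarrow> R4 x = R3 x"
          have env4: "env B n L R4" by (rule env_frame[OF env3]) (auto intro!: fr4)
          have R4: "R4 6 = ?c" "R4 7 = ?r" "R4 8 = R3 8" "R4 20 = R3 20"
            using fr4[of 6] fr4[of 7] fr4[of 8] fr4[of 20] R3 by simp_all
          have "orients n A (cell n M4) \<and> height_inv n ?c ?r (cell n M4) (hgt L M4) \<and>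
              potential n (cell n M4) (hgt L M4) < potential n (cell n M2) (hgt L M2)"
            using act unfolding M3
          proof (elim disjE exE conjE)
            fix y assume y: "y < n" "admissible n L M2 v y" "M4 = pushed n M2 v y"
            then have vy: "v \<noteq> y" by (auto simp: admissible_def)
            note ps = push_step[OF o2 hi2 v(1) y(1) v(2)[unfolded excess_def]
                y(2)[unfolded admissible_def, THEN conjunct1] y(2)[unfolded admissible_def, THEN conjunct2]]
            have c4: "\<And>i j. i < n \<Longrightarrow> j < n \<Longrightarrow> cell n M4 i j = push v y (cell n M2) i j"
              unfolding y(3) using v(1) y(1) vy by (simp add: cell_pushed)
            have h4: "\<And>u. hgt L M4 u = hgt L M2 u" unfolding y(3) using v(1) y(1) assms(2) by (rule hgt_pushed)
            show ?thesis
              using ps orients_cong[of n "cell n M4" "push v y (cell n M2)" A]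
                height_inv_cong[of n "hgt L M4" "hgt L M2" "cell n M4" "push v y (cell n M2)" ?c ?r]
                potential_cong[of n "hgt L M4" "hgt L M2" "cell n M4" "push v y (cell n M2)"] c4 h4 by simp
          next
            assume na: "\<forall>y<n. \<not> admissible n L M2 v y" and M4: "M4 = M2(L + v := Suc (hgt L M2 v))"
            have c4: "\<And>i j. i < n \<Longrightarrow> j < n \<Longrightarrow> cell n M4 i j = cell n M2 i j"
              unfolding M4 using assms(2) by (intro cell_upd)
            have h4: "hgt L M4 = (hgt L M2)(v := Suc (hgt L M2 v))" unfolding M4 by (rule hgt_upd)
            have na': "hgt L M2 v \<noteq> Suc (hgt L M2 y)" if "y < n" "0 < cell n M2 v y" for y
              using na that by (auto simp: admissible_def)
            note rs = relabel_step[OF o2 hi2 v(1) irr[OF v(1)] v(2)[unfolded excess_def] v(3) na']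
            show ?thesis
              using rs o2 orients_cong[of n "cell n M4" "cell n M2" A]
                height_inv_cong[of n "hgt L M4" "hgt L M4" "cell n M4" "cell n M2" ?c ?r]
                potential_cong[of n "hgt L M4" "hgt L M4" "cell n M4" "cell n M2"] c4 unfolding h4 by simp
          qed
          then show "?P R4 M4 \<and> ?f R4 M4 < ?f R2 M2"
            using env4 R4 of3 f3 20 3(2) by simp
        qed
      qed
    qed
  next
    case (4 R2 M2)
    then have o2: "orients n A (cell n M2)"
      and f2: "R2 8 \<noteq> 0 \<Longrightarrow> R 8 \<noteq> 0 \<or> overfull n A ?c ?r" "R 8 \<noteq> 0 \<Longrightarrow> R2 8 \<noteq> 0"
      and ne: "R2 8 = 0 \<Longrightarrow> \<forall>v<n. \<not> excess n ?c ?r M2 v" by auto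
    have "\<not> overfull n A ?c ?r" if "R2 8 = 0"
      using ne[OF that] by (intro not_overfull_if_no_excess[OF o2]) (simp add: excess_def not_less)
    then show ?case using o2 f2 by blast
  qed
qed (use assms in auto)

definition all_roots :: com where
  "all_roots = Seq (Const 8 0) (Seq (Move 7 3) (For 7 root))"

lemma runs_all_roots:
  assumes "env B n L R" "Suc n + n * n \<le> L" "(2 * n + 1) * n * n < B"
    and ori: "orients n A (cell n M)" and irr: "\<And>v. v < n \<Longrightarrow> \<not> A v v"
  shows "runs B all_roots R M (\<lambda>R' M'. R' 8 \<noteq> 0 \<longleftrightarrow> (\<exists>r<n. overfull n A (R 6) r))"
  unfolding all_roots_def
proof (rule runs_Seq, rule runs_Const, rule runs_For_env[where L = L and n = n and
      P = "\<lambda>j R' M'. orients n A (cell n M') \<and> (R' 8 \<noteq> 0 \<longleftrightarrow> (\<exists>r<n. j \<le> r \<and> overfull n A (R 6) r))"],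
    goal_cases)
  case (11 j R' M')
  then have o: "orients n A (cell n M')" by simp
  have R': "R' 6 = R 6" using 11(5)[of 6] by simp
  show ?case
    using 11(1,2,3) R' unfolding ex_ge_Suc[of n j]
    by (intro runs_mono[OF runs_root[OF 11(4) assms(2,3) o irr]]) auto
qed (use assms in auto)

section \<open>Validating the adjacency matrix\<close>

text \<open>Violations are added up in register 9, which never decreases and so remains zero only
  for a valid matrix. Equality is tested by truncated differences in both directions.\<close>

definition entry_test :: com where
  "entry_test = Seq (Sub 16 14 15) (Seq (Sub 17 15 14) (Seq (Add 9 9 16) (Seq (Add 9 9 17)
    (Seq (Sub 16 10 11) (Seq (Sub 17 11 10) (Seq (Add 16 16 17) (If 16 Skip (Add 9 9 14))))))))"

lemma writes_entry_test [simp]: "writes entry_test = {9, 13, 16, 17}"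
  and storeless_entry_test [simp]: "storeless entry_test"
  by (auto simp: entry_test_def)

lemma runs_entry_test:
  "runs B entry_test R M (\<lambda>R' M'. R' 9 = 0 \<longleftrightarrow> R 9 = 0 \<and> R 14 = R 15 \<and> (R 10 = R 11 \<longrightarrow> R 14 = 0))"
  unfolding entry_test_def
proof (intro runs_intros, goal_cases)
  case 1
  then show ?case by simp arith
next
  case 2
  then show ?case by simp arith
qed

definition check :: com where
  "check = Seq (Const 9 0) (Seq (Move 10 3) (For 10 (Seq (Move 11 3) (For 11
    (Seq (get 14 10 11) (Seq (get 15 11 10) entry_test))))))"

lemma writes_check [simp]: "writes check = {9, 10, 11, 12, 13, 14, 15, 16, 17}"
  and storeless_check [simp]: "storeless check"
  by (auto simp: check_def)

definition valid_entry :: "(nat \<Rightarrow> nat \<Rightarrow> nat) \<Rightarrow> nat \<Rightarrow> nat \<Rightarrow> bool" where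
  "valid_entry D i j \<longleftrightarrow> D i j = D j i \<and> (i = j \<longrightarrow> D i j = 0)"

lemma runs_check:
  assumes "env B n L R"
  shows "runs B check R M (\<lambda>R' M'. R' 9 = 0 \<longleftrightarrow>
    (\<forall>i<n. \<forall>j<n. valid_entry (cell n M) i j))"
  unfolding check_def
proof (rule runs_Seq, rule runs_Const, rule runs_For_env[where L = L and n = n and
      P = "\<lambda>i R' M'. R' 9 = 0 \<longleftrightarrow> (\<forall>u<n. i \<le> u \<longrightarrow>
        (\<forall>j<n. valid_entry (cell n M) u j))"],
    goal_cases)
  case (11 i R1 M1)
  have M1: "M1 = M" using 11(6) by simp
  show ?case
  proof (rule runs_For_env[where L = L and n = n and
      P = "\<lambda>j R' M'. R' 9 = 0 \<longleftrightarrow> R1 9 = 0 \<and> (\<forall>u<n. j \<le> u \<longrightarrow>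
        valid_entry (cell n M) i u)"], goal_cases)
    case (11 j R2 M2)
    have M2: "M2 = M" using 11(6) M1 by simp
    have R2: "R2 10 = i" "R2 11 = j" using 11(5)[of 10] \<open>R1 10 = i\<close> 11(3) by simp_all
    have B: "n \<le> B" using assms(1) by (simp add: env_def)
    have eq: "(R1 9 = 0 \<and> (\<forall>u<n. j \<le> u \<longrightarrow> valid_entry (cell n M) i u)) \<longleftrightarrow>
        R2 9 = 0 \<and> valid_entry (cell n M) i j"
      using 11(1,2) all_ge_Suc[of n j "\<lambda>u. valid_entry (cell n M) i u"] by argo
    show ?case
      unfolding eq
    proof (rule runs_Seq, rule runs_mono[OF runs_get[OF 11(4), where Q = "\<lambda>R M'. R 14 = cell n M i j"]],
        goal_cases)
      case (5 R3 M3)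
      have M3: "M3 = M" using 5(3) M2 by simp
      have fr3: "R3 x = R2 x" if "x \<notin> {12, 13, 14}" for x using 5(2)[of x] that by simp
      have env3: "env B n L R3" by (rule env_frame[OF 11(4)]) (auto intro!: fr3)
      have R3: "R3 11 = j" "R3 10 = i" "R3 9 = R2 9" using fr3 R2 by simp_all
      show ?case
      proof (rule runs_Seq, rule runs_mono[OF runs_get[OF env3, where Q = "\<lambda>R M'. R 15 = cell n M j i"]],
          goal_cases)
        case (5 R4 M4)
        have fr4: "R4 x = R3 x" if "x \<notin> {12, 13, 15}" for x using 5(2)[of x] that by simp
        have R4: "R4 11 = j" "R4 10 = i" "R4 9 = R2 9" "R4 14 = cell n M i j" "R4 15 = cell n M j i"
          using fr4 R3 5(1) \<open>R3 14 = cell n M i j\<close> by simp_all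
        show ?case
          by (rule runs_mono[OF runs_entry_test]) (simp add: R4 valid_entry_def)
      qed (use R3 B \<open>j < n\<close> M3 in simp_all)
    qed (use R2 B \<open>i < n\<close> M2 in simp_all)
  next
    case (12 R2 M2)
    have "R2 9 = 0 \<longleftrightarrow> R1 9 = 0 \<and> (\<forall>u<n. valid_entry (cell n M) i u)"
      using 12(1) by (simp only: le0 simp_thms)
    then show ?case
      using \<open>i < n\<close> \<open>(R1 9 = 0) = _\<close> all_ge_Suc[of n i "\<lambda>u. \<forall>j<n. valid_entry (cell n M) u j"]
      by argo
  qed (use \<open>env B n L R1\<close> in auto)
qed (use assms in auto)

section \<open>Overfull sets and dense sets\<close>

text \<open>Double counting: each edge inside \<open>S\<close> arises from its two ordered
  pairs.\<close>

lemma sum_adjacency: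
  fixes S :: "'a set"
  assumes "finite S" "\<And>e. e \<in> E \<Longrightarrow> card e = 2"
  shows "(\<Sum>i\<in>S. \<Sum>j\<in>S. of_bool ({i, j} \<in> E)) = 2 * card {e\<in>E. e \<subseteq> S}"
proof -
  let ?F = "{e\<in>E. e \<subseteq> S}"
  have finF: "finite ?F" using finite_subset[of ?F "Pow S"] assms(1) by auto
  have "(of_bool ({i, j} \<in> E) :: nat) = (\<Sum>e\<in>?F. of_bool ({i, j} = e))" if "i \<in> S" "j \<in> S" for i j
  proof -
    have "(\<Sum>e\<in>?F. of_bool ({i, j} = e)) = (\<Sum>e\<in>?F. if e = {i, j} then 1 else (0::nat))"
      by (intro sum.cong) auto
    also have "\<dots> = of_bool ({i, j} \<in> ?F)" using finF by (simp add: sum.delta')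
    finally show ?thesis using that by simp
  qed
  then have "(\<Sum>i\<in>S. \<Sum>j\<in>S. of_bool ({i, j} \<in> E)) = (\<Sum>i\<in>S. \<Sum>j\<in>S. \<Sum>e\<in>?F. (of_bool ({i, j} = e) :: nat))"
    by (intro sum.cong refl) blast
  also have "\<dots> = (\<Sum>i\<in>S. \<Sum>e\<in>?F. \<Sum>j\<in>S. of_bool ({i, j} = e))"
    by (intro sum.cong refl sum.swap)
  also have "\<dots> = (\<Sum>e\<in>?F. \<Sum>i\<in>S. \<Sum>j\<in>S. of_bool ({i, j} = e))" by (rule sum.swap)
  also have "\<dots> = (\<Sum>e\<in>?F. 2)"
  proof (intro sum.cong refl)
    fix e assume "e \<in> ?F"
    then obtain u v where e: "e = {u, v}" "u \<noteq> v" "u \<in> S" "v \<in> S"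
      using assms(2)[of e] by (auto simp: card_2_iff)
    \<comment> \<open>For fixed \<open>i\<close>, exactly one \<open>j\<close> completes the edge if
      \<open>i\<close> is one of its ends, and none does otherwise.\<close>
    have "(\<Sum>j\<in>S. of_bool ({i, j} = e)) = (if i = u then 1 else 0) + (if i = v then 1 else (0::nat))"
      if "i \<in> S" for i
    proof -
      have "(\<Sum>j\<in>S. of_bool ({i, j} = e)) =
          (\<Sum>j\<in>S. (if j = v then of_bool (i = u) else 0) + (if j = u then of_bool (i = v) else (0::nat)))"
        using e(2) by (intro sum.cong) (auto simp: e(1) doubleton_eq_iff)
      then show ?thesis using e assms(1) by (simp add: sum.distrib)
    qed
    then have "(\<Sum>i\<in>S. \<Sum>j\<in>S. of_bool ({i, j} = e)) =
        (\<Sum>i\<in>S. (if i = u then 1 else 0) + (if i = v then 1 else (0::nat)))" by (intro sum.cong) auto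
    then show "(\<Sum>i\<in>S. \<Sum>j\<in>S. of_bool ({i, j} = e)) = (2::nat)"
      using e assms(1) by (simp add: sum.distrib)
  qed
  finally show ?thesis by simp
qed

lemma sum_cap:
  assumes "finite S" shows "sum (cap c r) S = c * card (S - {r})"
proof -
  have "sum (cap c r) S = sum (cap c r) (S - {r})"
    using assms by (intro sum.mono_neutral_right) (auto simp: cap_def)
  also have "\<dots> = (\<Sum>v\<in>S - {r}. c)" by (intro sum.cong) (auto simp: cap_def)
  finally show ?thesis by simp
qed

text \<open>The capacity is \<open>2 * t\<close> because the sum counts each edge twice. A root
  inside \<open>S\<close> leaves \<open>card S - 1\<close> vertices with that capacity.\<close>

lemma overfull_iff_dense:
  assumes "finite_graph {..<n} E" "\<And>i j. i < n \<Longrightarrow> j < n \<Longrightarrow> A i j \<longleftrightarrow> {i, j} \<in> E"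
  shows "(\<exists>r<n. overfull n A (2 * t) r) \<longleftrightarrow> dense {..<n} E t"
proof -
  have eq: "(\<Sum>i\<in>S. \<Sum>j\<in>S. of_bool (A i j)) = 2 * card {e\<in>E. e \<subseteq> S}" if "S \<subseteq> {..<n}" for S
  proof -
    have "(\<Sum>i\<in>S. \<Sum>j\<in>S. of_bool (A i j) :: nat) = (\<Sum>i\<in>S. \<Sum>j\<in>S. of_bool ({i, j} \<in> E))"
      using assms(2) that by (intro sum.cong) auto
    also have "\<dots> = 2 * card {e\<in>E. e \<subseteq> S}"
      using assms(1) that finite_subset by (intro sum_adjacency) (auto simp: finite_graph_def)
    finally show ?thesis .
  qed
  show ?thesis
  proof
    assume "\<exists>r<n. overfull n A (2 * t) r"
    then obtain r S where S: "S \<subseteq> {..<n}" "sum (cap (2 * t) r) S < (\<Sum>i\<in>S. \<Sum>j\<in>S. of_bool (A i j))"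
      by (auto simp: overfull_def)
    then have fin: "finite S" using finite_subset by blast
    have "2 * t * card (S - {r}) < 2 * card {e\<in>E. e \<subseteq> S}" using S(2) unfolding eq[OF S(1)] sum_cap[OF fin] .
    \<comment> \<open>A root outside \<open>S\<close> only makes it harder to be overfull, so
      \<open>S\<close> is dense in that case too.\<close>
    moreover have "2 * t * (card S - 1) \<le> 2 * t * card (S - {r})"
      using fin by (intro mult_left_mono) (auto simp: card_Diff_singleton_if)
    ultimately have "t * (card S - 1) < card {e\<in>E. e \<subseteq> S}" by linarith
    moreover have "S \<noteq> {}" using S(2) by auto
    ultimately show "dense {..<n} E t" using S(1) unfolding dense_def by blast
  next
    assume "dense {..<n} E t"
    then obtain S where S: "S \<subseteq> {..<n}" "S \<noteq> {}" "t * (card S - 1) < card {e\<in>E. e \<subseteq> S}"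
      unfolding dense_def by blast
    then have fin: "finite S" using finite_subset by blast
    obtain r where r: "r \<in> S" using S(2) by blast
    have "sum (cap (2 * t) r) S < (\<Sum>i\<in>S. \<Sum>j\<in>S. of_bool (A i j))"
      unfolding eq[OF S(1)] sum_cap[OF fin] using S(3) r fin by simp
    then show "\<exists>r<n. overfull n A (2 * t) r" using S(1) r unfolding overfull_def by blast
  qed
qed

section \<open>Decoding\<close>

definition bin_value :: "bool list \<Rightarrow> nat" where
  "bin_value bs = foldl (\<lambda>a b. 2 * a + of_bool b) 0 bs"

lemma bin_value_Nil [simp]: "bin_value [] = 0"
  by (simp add: bin_value_def)

lemma bin_value_snoc [simp]: "bin_value (bs @ [b]) = 2 * bin_value bs + of_bool b"
  by (simp add: bin_value_def)

lemma bin_value_binary [simp]: "bin_value (binary n) = n"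
proof (induction n rule: less_induct)
  case (less n)
  show ?case
  proof (cases "n = 0")
    case False
    then have "bin_value (binary n) = 2 * (n div 2) + of_bool (odd n)"
      using less[of "n div 2"] by (subst binary.simps) simp
    then show ?thesis by (simp add: odd_two_times_div_two_succ)
  qed (simp add: binary.simps)
qed

lemma bin_value_pos: "bs \<noteq> [] \<Longrightarrow> hd bs \<Longrightarrow> 0 < bin_value bs"
proof (induction bs rule: rev_induct)
  case (snoc b bs)
  then show ?case
    using bin_value_snoc[of "[]" True] by (cases "bs = []") (auto simp del: bin_value_snoc, simp_all)
qed simp

text \<open>Without leading zeros a number has only one representation; this is why the first bit of
  the number field is tested.\<close>

lemma binary_of_bin_value: "bs \<noteq> [] \<Longrightarrow> hd bs \<Longrightarrow> binary (bin_value bs) = bs"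
proof (induction bs rule: rev_induct)
  case (snoc b bs)
  have "bin_value (bs @ [b]) \<noteq> 0" using bin_value_pos[OF snoc.prems] by simp
  moreover have "bin_value (bs @ [b]) div 2 = bin_value bs" "odd (bin_value (bs @ [b])) = b" by (cases b; simp)+
  ultimately have "binary (bin_value (bs @ [b])) = binary (bin_value bs) @ [b]"
    by (subst binary.simps) simp
  moreover have "binary (bin_value bs) = bs"
    using snoc by (cases "bs = []") (auto simp: binary.simps)
  ultimately show ?case by simp
qed simp

lemma binary_hd: "0 < n \<Longrightarrow> binary n \<noteq> [] \<and> hd (binary n)"
proof (induction n rule: less_induct)
  case (less n)
  then show ?case
    by (subst (1 2) binary.simps, cases "n div 2 = 0")
      (use less.IH[of "n div 2"] less.prems in \<open>auto simp: binary.simps[of 0] hd_append\<close>)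
qed

section \<open>The fields of an input word\<close>

definition rows :: "nat \<Rightarrow> nat \<Rightarrow> (nat \<Rightarrow> nat \<Rightarrow> 'a) \<Rightarrow> 'a list" where
  "rows m n f = concat (map (\<lambda>i. map (f i) [0..<n]) [0..<m])"

lemma rows_Suc: "rows (Suc m) n f = rows m n f @ map (f m) [0..<n]"
  by (simp add: rows_def)

lemma length_rows [simp]: "length (rows m n f) = m * n"
  by (induction m) (simp_all add: rows_Suc, simp add: rows_def)

lemma nth_rows: "i < m \<Longrightarrow> j < n \<Longrightarrow> rows m n f ! (i * n + j) = f i j"
proof (induction m)
  case (Suc m)
  show ?case
  proof (cases "i = m")
    case True
    then show ?thesis using Suc.prems by (simp add: rows_Suc nth_append)
  next
    case False
    then have "i < m" using Suc.prems by simp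
    then have "Suc i * n \<le> m * n" by (intro mult_right_mono) auto
    then have "i * n + j < m * n" using Suc.prems by simp
    then show ?thesis using Suc \<open>i < m\<close> by (simp add: rows_Suc nth_append)
  qed
qed simp

lemma rows_nth: "m * n \<le> length xs \<Longrightarrow> rows m n (\<lambda>i j. xs ! (i * n + j)) = take (m * n) xs"
proof (induction m)
  case (Suc m)
  have "map (\<lambda>j. xs ! (m * n + j)) [0..<n] = take n (drop (m * n) xs)"
    using Suc.prems by (intro nth_equalityI) auto
  then show ?case using Suc by (simp add: rows_Suc take_add[symmetric] add.commute)
qed (simp add: rows_def)

lemma encode_rows: "encode n E k = replicate n True @ False # rows n n (\<lambda>i j. {i, j} \<in> E) @ binary k"
  by (simp add: encode_def rows_def)

text \<open>The initial memory of the machine, zero beyond the input.\<close>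

definition bits :: "bool list \<Rightarrow> nat \<Rightarrow> nat" where
  "bits w a = (if a < length w then of_bool (w ! a) else 0)"

definition unary :: "bool list \<Rightarrow> nat" where
  "unary w = length (takeWhile id w)"

lemma unary_le: "unary w \<le> length w"
  unfolding unary_def by (rule length_takeWhile_le)

lemma bits_unary: "i < unary w \<Longrightarrow> bits w i = 1" "bits w (unary w) = 0"
proof -
  assume "i < unary w"
  then show "bits w i = 1"
    using set_takeWhileD[of _ id w] takeWhile_nth[of i id w] unary_le[of w] nth_mem[of i "takeWhile id w"]
    by (auto simp: bits_def unary_def)
next
  show "bits w (unary w) = 0"
    using nth_length_takeWhile[of id w] by (auto simp: bits_def unary_def)
qed

definition number_start :: "bool list \<Rightarrow> nat" where
  "number_start w = Suc (unary w) + unary w * unary w"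

text \<open>One bit test replaces all checks of the format: memory beyond the input is 0, so the bit
  at \<open>number_start w\<close> is set only if the end marker, the whole matrix and a number
  without leading zero are present.\<close>

definition accepted :: "bool list \<Rightarrow> bool" where
  "accepted w \<longleftrightarrow> (let n = unary w; D = cell n (bits w); k = bin_value (drop (number_start w) w) in
     bits w (number_start w) \<noteq> 0 \<and> 2 \<le> k \<and> (\<forall>i<n. \<forall>j<n. valid_entry D i j) \<and>
     (\<exists>r<n. overfull n (\<lambda>i j. D i j \<noteq> 0) (4 * (k - 1)) r))"

lemma accepted_iff_dense:
  assumes "bits w (number_start w) \<noteq> 0" "2 \<le> bin_value (drop (number_start w) w)"
    "\<And>i j. i < unary w \<Longrightarrow> j < unary w \<Longrightarrow> valid_entry (cell (unary w) (bits w)) i j"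
    "\<And>i j. i < unary w \<Longrightarrow> j < unary w \<Longrightarrow> cell (unary w) (bits w) i j \<noteq> 0 \<longleftrightarrow> {i, j} \<in> E"
    "finite_graph {..<unary w} E"
  shows "accepted w \<longleftrightarrow> maker_wins_arboricity (bin_value (drop (number_start w) w)) E"
proof -
  let ?k = "bin_value (drop (number_start w) w)"
  have "maker_wins_arboricity ?k E \<longleftrightarrow> dense {..<unary w} E (2 * ?k - 2)"
    using maker_wins_arboricity_iff_dense[OF assms(5,2)] .
  also have "\<dots> \<longleftrightarrow> (\<exists>r<unary w. overfull (unary w) (\<lambda>i j. cell (unary w) (bits w) i j \<noteq> 0) (2 * (2 * ?k - 2)) r)"
    using overfull_iff_dense[OF assms(5,4)] by simp
  also have "2 * (2 * ?k - 2) = 4 * (?k - 1)" by simp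
  finally show ?thesis using assms(1-3) by (simp add: accepted_def Let_def)
qed

lemma accepted_encode:
  assumes "finite_graph {..<n} E" "2 \<le> k"
  shows "accepted (encode n E k) \<longleftrightarrow> maker_wins_arboricity k E"
proof -
  let ?w = "encode n E k"
  have u: "unary ?w = n" by (simp add: unary_def encode_rows takeWhile_append)
  then have s: "number_start ?w = Suc n + n * n" by (simp add: number_start_def)
  have d: "drop (number_start ?w) ?w = binary k" unfolding s by (simp add: encode_rows)
  have len: "length ?w = Suc n + n * n + length (binary k)" by (simp add: encode_rows)
  have "?w ! number_start ?w = hd (binary k)"
    using binary_hd[of k] assms(2) d len s by (metis hd_drop_conv_nth length_greater_0_conv less_add_same_cancel1
        less_le_trans pos2)
  then have start: "bits ?w (number_start ?w) \<noteq> 0"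
    using binary_hd[of k] assms(2) len s by (simp add: bits_def)
  have c: "cell n (bits ?w) i j = of_bool ({i, j} \<in> E)" if "i < n" "j < n" for i j
  proof -
    have "loc n i j < Suc n + n * n" using loc_less[OF that order_refl] .
    moreover from this have "i * n + j < n * n" by (simp add: loc_def)
    then have "?w ! loc n i j = ({i, j} \<in> E)"
      using nth_rows[OF that, of "\<lambda>i j. {i, j} \<in> E"] by (simp add: encode_rows loc_def nth_append)
    ultimately show ?thesis using len by (simp add: cell_def bits_def)
  qed
  have irr: "{i, i} \<notin> E" for i using assms(1) by (auto simp: finite_graph_def)
  have "accepted ?w \<longleftrightarrow> maker_wins_arboricity (bin_value (drop (number_start ?w) ?w)) E"
    using assms start irr by (intro accepted_iff_dense)
      (auto simp: u d c valid_entry_def insert_commute)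
  then show ?thesis by (simp add: d)
qed

text \<open>Rejecting malformed words is part of deciding the language. An accepted word is shown to
  be literally the encoding of what is read from it.\<close>

lemma encode_if_accepted:
  assumes "accepted w"
  shows "\<exists>n E k. w = encode n E k \<and> finite_graph {..<n} E \<and> 2 \<le> k"
proof -
  define n where "n = unary w"
  define k where "k = bin_value (drop (number_start w) w)"
  define E where "E = {{i, j} | i j. i < n \<and> j < n \<and> cell n (bits w) i j \<noteq> 0}"
  have start: "bits w (number_start w) \<noteq> 0" and k: "2 \<le> k"
    and valid: "\<And>i j. i < n \<Longrightarrow> j < n \<Longrightarrow> valid_entry (cell n (bits w)) i j"
    using assms by (auto simp: accepted_def Let_def n_def k_def)
  have s: "number_start w = Suc n + n * n" by (simp add: number_start_def n_def)
  have len: "Suc n + n * n < length w" "w ! (Suc n + n * n)"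
    using start by (auto simp: bits_def s split: if_splits)
  \<comment> \<open>Symmetry of the matrix makes an entry depend only on the unordered pair.\<close>
  have E: "{i, j} \<in> E \<longleftrightarrow> cell n (bits w) i j \<noteq> 0" if "i < n" "j < n" for i j
    using valid that unfolding E_def valid_entry_def by (auto simp: doubleton_eq_iff)
  have "w = replicate n True @ False # take (n * n) (drop (Suc n) w) @ drop (Suc n + n * n) w"
  proof -
    have "take n w = replicate n True"
      unfolding n_def unary_def takeWhile_eq_take[symmetric]
      using set_takeWhileD[of _ id w] by (metis id_apply replicate_eqI)
    moreover have "\<not> w ! n" using bits_unary(2)[of w] len by (simp add: bits_def n_def split: if_splits)
    then have "drop n w = False # drop (Suc n) w" using len Cons_nth_drop_Suc[of n w] by simp
    moreover have "drop (Suc n) w = take (n * n) (drop (Suc n) w) @ drop (Suc n + n * n) w"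
      by (metis append_take_drop_id drop_drop add.commute)
    ultimately show ?thesis by (metis append_take_drop_id)
  qed
  moreover have "take (n * n) (drop (Suc n) w) = rows n n (\<lambda>i j. {i, j} \<in> E)"
  proof -
    have "take (n * n) (drop (Suc n) w) = rows n n (\<lambda>i j. drop (Suc n) w ! (i * n + j))"
      using len by (intro rows_nth[symmetric]) simp
    also have "\<dots> = rows n n (\<lambda>i j. {i, j} \<in> E)"
    proof -
      have "drop (Suc n) w ! (i * n + j) \<longleftrightarrow> {i, j} \<in> E" if "i < n" "j < n" for i j
        using loc_less[OF that order_refl] len E[OF that]
        by (simp add: cell_def bits_def loc_def add.assoc)
      then show ?thesis unfolding rows_def by (intro arg_cong[of _ _ concat] map_cong) auto
    qed
    finally show ?thesis .
  qed
  moreover have "drop (Suc n + n * n) w = binary k"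
  proof -
    have "drop (Suc n + n * n) w \<noteq> []" "hd (drop (Suc n + n * n) w)"
      using len by (simp_all add: hd_drop_conv_nth)
    then show ?thesis unfolding k_def s by (rule binary_of_bin_value[symmetric])
  qed
  ultimately have "w = encode n E k" by (simp add: encode_rows)
  moreover have "finite_graph {..<n} E"
    unfolding finite_graph_def
  proof (intro conjI ballI)
    fix e assume "e \<in> E"
    then obtain i j where e: "e = {i, j}" "i < n" "j < n" "cell n (bits w) i j \<noteq> 0" by (auto simp: E_def)
    then have "i \<noteq> j" using valid[of i j] by (auto simp: valid_entry_def)
    then show "e \<subseteq> {..<n}" "card e = 2" using e by auto
  qed simp
  ultimately show ?thesis using k by blast
qed

lemma accepted_iff: "accepted w \<longleftrightarrow> w \<in> arboricity_game_language"
  unfolding arboricity_game_language_def using accepted_encode encode_if_accepted by blast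

section \<open>The decision procedure\<close>

text \<open>On a word without end marker the scan stops at the first zero beyond the input.\<close>

definition read_unary :: com where
  "read_unary = Seq (Const 3 0) (Seq (Load 14 3) (While 14 (Seq (Add 3 3 1) (Load 14 3))))"

lemma writes_read_unary [simp]: "writes read_unary = {3, 14}"
  and storeless_read_unary [simp]: "storeless read_unary"
  by (auto simp: read_unary_def)

lemma runs_read_unary:
  assumes "R 1 = 1" "length w \<le> B"
  shows "runs B read_unary R (bits w) (\<lambda>R' M'. R' 3 = unary w)"
  unfolding read_unary_def
proof (rule runs_Seq, rule runs_Const, rule runs_Seq, rule runs_Load,
    rule runs_While[where P = "\<lambda>R' M'. M' = bits w \<and> R' 1 = 1 \<and> R' 3 \<le> unary w \<and> R' 14 = bits w (R' 3)"
      and f = "\<lambda>R' M'. unary w - R' 3"], goal_cases)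
  case (3 R' M')
  have "R' 3 \<noteq> unary w" using 3 bits_unary(2)[of w] by auto
  then show ?case using 3 by (intro runs_intros) auto
next
  case (4 R' M')
  then show ?case using bits_unary(1)[of "R' 3" w] by (cases "R' 3 < unary w") auto
qed (use assms unary_le[of w] in auto)

text \<open>Horner's scheme with doubling by addition, so the time depends on the number of bits and
  not on \<open>k\<close>.\<close>

definition read_number :: com where
  "read_number = Seq (Const 23 0) (Seq (Move 11 10) (Seq (Sub 15 5 11)
    (While 15 (Seq (Add 23 23 23) (Seq (Load 14 11) (Seq (Add 23 23 14) (Seq (Add 11 11 1) (Sub 15 5 11))))))))"

lemma writes_read_number [simp]: "writes read_number = {11, 14, 15, 23}"
  and storeless_read_number [simp]: "storeless read_number"
  by (auto simp: read_number_def)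

lemma runs_read_number:
  assumes "R 1 = 1" "R 2 = 0" "R 5 = length w" "R 10 \<le> length w" "length w \<le> B"
  shows "runs B read_number R (bits w) (\<lambda>R' M'. R' 23 = bin_value (drop (R 10) w))"
  unfolding read_number_def
proof (rule runs_Seq, rule runs_Const, rule runs_Seq, rule runs_Add, rule runs_Seq, rule runs_Sub,
    rule runs_While[where P = "\<lambda>R' M'. M' = bits w \<and> R' 1 = 1 \<and> R' 5 = length w \<and> R 10 \<le> R' 11 \<and>
      R' 11 \<le> length w \<and> R' 15 = length w - R' 11 \<and> R' 23 = bin_value (take (R' 11 - R 10) (drop (R 10) w))"
      and f = "\<lambda>R' M'. R' 15"], goal_cases)
  case (3 R' M')
  then have lt: "R' 11 < length w" by simp
  have "Suc (R' 11) - R 10 = Suc (R' 11 - R 10)" using 3 by (simp add: Suc_diff_le)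
  then have "take (Suc (R' 11) - R 10) (drop (R 10) w) = take (R' 11 - R 10) (drop (R 10) w) @ [w ! R' 11]"
    using 3 lt by (simp add: take_Suc_conv_app_nth)
  then show ?case using 3 lt by (intro runs_intros) (simp add: bits_def)
qed (use assms in auto)

text \<open>Register 23 holds \<open>k - 1\<close> on entry; two doublings give the capacity
  \<open>4 * (k - 1)\<close>.\<close>

definition decide_valid :: com where
  "decide_valid = Seq (Add 6 23 23) (Seq (Add 6 6 6) (Seq check (If 9 (Const 0 0) (Seq all_roots (Move 0 8)))))"

text \<open>After the decrement, register 23 is nonzero exactly if \<open>2 \<le> k\<close>.\<close>

definition decide :: com where
  "decide = Seq (Const 1 1) (Seq (Const 2 0) (Seq (Move 5 0) (Seq read_unary (Seq (Add 4 3 1)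
    (Seq (mult 3 3) (Seq (Add 10 12 4) (Seq (Load 14 10) (If 14
      (Seq read_number (Seq (Sub 23 23 1) (If 23 decide_valid (Const 0 0))))
      (Const 0 0)))))))))"

lemma bits_le: "bits w a \<le> 1"
  by (simp add: bits_def)

lemma writes_all_roots [simp]: "writes all_roots = {7, 8, 10, 11, 12, 13, 14, 15, 16, 17, 18, 19, 20, 21, 22}"
  by (auto simp: all_roots_def)

lemma runs_decide_valid:
  assumes "env B n L R" "Suc n + n * n \<le> L" "(2 * n + 1) * n * n < B"
  shows "runs B decide_valid R (bits w) (\<lambda>R' M'. R' 0 \<noteq> 0 \<longleftrightarrow>
    (\<forall>i<n. \<forall>j<n. valid_entry (cell n (bits w)) i j) \<and>
    (\<exists>r<n. overfull n (\<lambda>i j. cell n (bits w) i j \<noteq> 0) (4 * R 23) r))"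
  unfolding decide_valid_def
proof (rule runs_Seq, rule runs_Add, rule runs_Seq, rule runs_Add, rule runs_Seq, rule runs_mono,
    rule runs_check[where n = n and L = L], goal_cases)
  case (2 R1 M1)
  have M1: "M1 = bits w" using 2(3) by simp
  have R1: "R1 6 = 4 * R 23" using 2(2)[of 6] by simp
  have env1: "env B n L R1" by (rule env_frame[OF assms(1)]) (use 2(2) in auto)
  show ?case
  proof (rule runs_If)
    assume "R1 9 \<noteq> 0"
    then show "runs B (Const 0 0) R1 M1 (\<lambda>R' M'. R' 0 \<noteq> 0 \<longleftrightarrow>
      (\<forall>i<n. \<forall>j<n. valid_entry (cell n (bits w)) i j) \<and>
      (\<exists>r<n. overfull n (\<lambda>i j. cell n (bits w) i j \<noteq> 0) (4 * R 23) r))"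
      using 2(1) by (intro runs_Const) auto
  next
    assume "R1 9 = 0"
    then have valid: "\<And>i j. i < n \<Longrightarrow> j < n \<Longrightarrow> valid_entry (cell n (bits w)) i j" using 2(1) by blast
    let ?A = "\<lambda>i j. cell n (bits w) i j \<noteq> 0"
    have "cell n (bits w) i j + cell n (bits w) j i = 2 * of_bool (?A i j)" if "i < n" "j < n" for i j
      using valid[OF that] bits_le[of w "loc n i j"] by (auto simp: valid_entry_def cell_def)
    then have o: "orients n ?A (cell n M1)" by (simp add: orients_def M1)
    have irr: "\<not> ?A v v" if "v < n" for v using valid[OF that that] by (simp add: valid_entry_def)
    show "runs B (Seq all_roots (Move 0 8)) R1 M1 (\<lambda>R' M'. R' 0 \<noteq> 0 \<longleftrightarrow>
      (\<forall>i<n. \<forall>j<n. valid_entry (cell n (bits w)) i j) \<and>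
      (\<exists>r<n. overfull n (\<lambda>i j. cell n (bits w) i j \<noteq> 0) (4 * R 23) r))"
    proof (rule runs_Seq, rule runs_mono[OF runs_all_roots[OF env1 assms(2,3) o irr]], goal_cases)
      case (2 R2 M2)
      have "R2 2 = 0" using 2(2)[of 2] env1 by (simp add: env_def)
      then show ?case using 2(1) valid by (intro runs_Add) (simp add: R1)
    qed simp
  qed
qed (use assms in simp)

lemma runs_decide:
  assumes "(2 * length w + 1) * length w * length w + length w + 2 \<le> B"
  shows "runs B decide ((\<lambda>_. 0)(0 := length w)) (bits w) (\<lambda>R' M'. R' 0 \<noteq> 0 \<longleftrightarrow> accepted w)"
  unfolding decide_def
proof (rule runs_Seq, rule runs_Const, rule runs_Seq, rule runs_Const, rule runs_Seq, rule runs_Add,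
    rule runs_Seq, rule runs_mono, rule runs_read_unary[where w = w], goal_cases)
  case (3 R1 M1)
  let ?n = "unary w" and ?L = "length w"
  have nL: "?n \<le> ?L" by (rule unary_le)
  \<comment> \<open>\<open>B\<close> has to exceed the initial potential of every call of
    \<open>root\<close>; its remaining summands cover the loops over vertices and input
    bits.\<close>
  have nB: "(2 * ?n + 1) * ?n * ?n < B"
  proof -
    have "(2 * ?n + 1) * ?n * ?n \<le> (2 * ?L + 1) * ?L * ?L" using nL by (intro mult_mono) auto
    then show ?thesis using assms by simp
  qed
  have LB: "?L \<le> B" using assms by simp
  have M1: "M1 = bits w" using 3(3) by simp
  have R1: "R1 1 = 1" "R1 2 = 0" "R1 5 = ?L" "R1 3 = ?n"
    using 3(1) 3(2)[of 1] 3(2)[of 2] 3(2)[of 5] by simp_all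
  show ?case
  proof (rule runs_Seq, rule runs_Add, rule runs_Seq, rule runs_mult, goal_cases)
    case 6
    let ?R2 = "\<lambda>R2. R2 10 = number_start w \<and> R2 14 = bits w (number_start w) \<and> env B ?n ?L R2"
    show ?case
    proof (rule runs_Seq, rule runs_Add, rule runs_Seq, rule runs_Load)
      let ?S = "R1(4 := R1 3 + R1 1)"
      let ?T = "?S(12 := ?S 3 * ?S 3, 13 := 0)"
      let ?U = "?T(10 := ?T 12 + ?T 4)"
      define R2 where "R2 = ?U(14 := M1 (?U 10))"
      have R2: "R2 10 = number_start w" "R2 14 = bits w (number_start w)" "env B ?n ?L R2"
        using R1 nL LB by (simp_all add: R2_def number_start_def M1 env_def add.commute)
      have "runs B (If 14 (Seq read_number (Seq (Sub 23 23 1) (If 23 decide_valid (Const 0 0)))) (Const 0 0))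
          R2 (bits w) (\<lambda>R' M'. R' 0 \<noteq> 0 \<longleftrightarrow> accepted w)"
      proof (rule runs_If)
        assume "R2 14 = 0"
        then show "runs B (Const 0 0) R2 (bits w) (\<lambda>R' M'. R' 0 \<noteq> 0 \<longleftrightarrow> accepted w)"
          using R2(2) by (intro runs_Const) (simp add: accepted_def Let_def)
      next
        assume "R2 14 \<noteq> 0"
        then have start: "bits w (number_start w) \<noteq> 0" using R2(2) by simp
        then have sL: "number_start w < ?L" by (simp add: bits_def split: if_splits)
        show "runs B (Seq read_number (Seq (Sub 23 23 1) (If 23 decide_valid (Const 0 0))))
          R2 (bits w) (\<lambda>R' M'. R' 0 \<noteq> 0 \<longleftrightarrow> accepted w)"
        proof (rule runs_Seq, rule runs_mono[OF runs_read_number], goal_cases)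
          case (6 R3 M3)
          have M3: "M3 = bits w" using 6(3) by simp
          have env3: "env B ?n ?L R3" by (rule env_frame[OF R2(3)]) (use 6(2) in auto)
          let ?k = "bin_value (drop (number_start w) w)"
          have R3: "R3 23 = ?k" "R3 1 = 1" using 6(1) R2(1) env3 by (simp_all add: env_def)
          show ?case
          proof (rule runs_Seq, rule runs_Sub, rule runs_If)
            assume "(R3(23 := R3 23 - R3 1)) 23 = 0"
            then have "\<not> 2 \<le> ?k" using R3 by simp
            then show "runs B (Const 0 0) (R3(23 := R3 23 - R3 1)) M3 (\<lambda>R' M'. R' 0 \<noteq> 0 \<longleftrightarrow> accepted w)"
              by (intro runs_Const) (simp add: accepted_def Let_def)
          next
            assume "(R3(23 := R3 23 - R3 1)) 23 \<noteq> 0"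
            then have k: "2 \<le> ?k" using R3 by simp
            have "env B ?n ?L (R3(23 := R3 23 - R3 1))" using env3 by simp
            then have "runs B decide_valid (R3(23 := R3 23 - R3 1)) (bits w) (\<lambda>R' M'. R' 0 \<noteq> 0 \<longleftrightarrow>
              (\<forall>i<?n. \<forall>j<?n. valid_entry (cell ?n (bits w)) i j) \<and>
              (\<exists>r<?n. overfull ?n (\<lambda>i j. cell ?n (bits w) i j \<noteq> 0) (4 * (R3(23 := R3 23 - R3 1)) 23) r))"
              using sL nB by (intro runs_decide_valid) (auto simp: number_start_def)
            then show "runs B decide_valid (R3(23 := R3 23 - R3 1)) M3 (\<lambda>R' M'. R' 0 \<noteq> 0 \<longleftrightarrow> accepted w)"
              unfolding M3 by (rule runs_mono) (use start k R3 in \<open>simp add: accepted_def Let_def\<close>)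
          qed
        qed (use R2 sL LB in \<open>simp_all add: env_def\<close>)
      qed
      then show "runs B (If 14 (Seq read_number (Seq (Sub 23 23 1) (If 23 decide_valid (Const 0 0)))) (Const 0 0))
          (?U(14 := M1 (?U 10))) M1 (\<lambda>R' M'. R' 0 \<noteq> 0 \<longleftrightarrow> accepted w)"
        unfolding R2_def M1 .
    qed
  qed (use R1 nL LB in simp_all)
qed (use assms in simp_all)

lemma arboricity_game_polynomial_time: "polynomial_time_decidable arboricity_game_language"
proof -
  obtain p where p: "\<And>B. steps B decide = poly p B" using steps_poly by blast
  let ?B = "\<lambda>L. (2 * L + 1) * L * L + L + (2::nat)"
  \<comment> \<open>Multiplied out, the bound is \<open>2 + L + L^2 + 2 * L^3\<close>.\<close>
  have B: "?B L = poly [:2, 1, 1, 2:] L" for L by (simp add: algebra_simps)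
  have "\<exists>t s. exec decide (initial_state w) t s \<and> t \<le> poly (pcompose p [:2, 1, 1, 2:]) (length w) \<and>
      (accepting s \<longleftrightarrow> w \<in> arboricity_game_language)" for w
  proof -
    have init: "initial_state w = ((\<lambda>_. 0)(0 := length w), bits w)"
      by (auto simp: initial_state_def bits_def)
    obtain t R M where t: "exec decide (initial_state w) t (R, M)" "t \<le> steps (?B (length w)) decide"
      "R 0 \<noteq> 0 \<longleftrightarrow> accepted w"
      using runs_decide[of w, OF order_refl] unfolding runs_def init by blast
    have "t \<le> poly (pcompose p [:2, 1, 1, 2:]) (length w)"
      using t(2) unfolding p B poly_pcompose .
    then show ?thesis using t(1,3) by (metis accepted_iff accepting_def fst_conv)
  qed
  then show ?thesis unfolding polynomial_time_decidable_def by blast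
qed

theorem theorem20:
  shows "(\<forall>(V :: 'a set) (E :: 'a set set) (k :: nat). finite_graph V E \<and> 2 \<le> k \<longrightarrow>
            (maker_wins_arboricity k E \<longleftrightarrow> int k \<le> \<lceil>real (arboricity E) / 2\<rceil>))
         \<and> polynomial_time_decidable arboricity_game_language"
  using maker_wins_arboricity_iff arboricity_game_polynomial_time by blast

end
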